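(* Let $(\gamma_+,\gamma_-)$ be an angularly regular parallel pair of cooriented frontal germs in $\mathbb{R}^2$ with common angular parameter $u$ near $0$: $\gamma_+'=\rho_+\mathbf e$, $\gamma_-'=-\rho_-\mathbf e$. Put $\Delta_\rho=\rho_+-\rho_-$, $\Sigma_\rho=\rho_++\rho_-$, $\Delta_\gamma=\gamma_+-\gamma_-$, $\mathcal J_\rho=\rho_+\rho_-'-\rho_-\rho_+'$, and assume $$\det(\Delta_\gamma(0),\mathbf e(0))\neq0,\qquad \rho_+(0)=\rho_-(0)\neq0 .$$ Let $\mathrm E_{1/2}=\frac12(\gamma_++\gamma_-)$ be the Wigner caustic branch and $S=\gamma_-+\frac{\rho_-}{\Sigma_\rho}\Delta_\gamma$ the centre symmetry set branch. If $\Delta_\rho$ has a zero of order $m\geq1$ at $0$, then $\mathcal J_\rho$ has a zero of order $m-1$ at $0$. Furthermore, $$\mathrm E_{1/2}(0)=S(0)=\frac{\gamma_+(0)+\gamma_-(0)}2 .$$ Consequently (at the parameter $0$): (i) if $\mathrm E_{1/2}$ has a $3/2$-cusp, then $S$ is regular there; (ii) if $\mathrm E_{1/2}$ has a $4/3$-cusp, then $S$ has a $3/2$-cusp there; (iii) if $\mathrm E_{1/2}$ has a $5/4$-cusp or a $(5/4;\pm7)$-cusp, then $S$ has a $4/3$-cusp there.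
   Context: A smooth germ $\gamma:(\mathbb R,0)\to\mathbb R^2$ is a cooriented frontal if it has a smooth unit normal field $\mathbf n$ with $\gamma'\cdot\mathbf n=0$; choosing the unit tangent field $\mathbf e=(\cos\theta,\sin\theta)$ so that $(\mathbf e,\mathbf n)$ is positively oriented, $\gamma'=\ell\mathbf e$ with smooth $\ell,\theta$. It is angularly regular if $\theta'\neq0$. Angularly regular parallel pair: two angularly regular cooriented frontal germs $\gamma_\pm$ whose tangent lines at the base points are parallel, tangent lifts chosen opposite at the base points. Both are parametrised by a common angular parameter $u$ near $0$, with $\gamma_+'(u)=\rho_+(u)\mathbf e(u)$, $\gamma_-'(u)=-\rho_-(u)\mathbf e(u)$, where $\mathbf e(u)=(\cos(u+\theta_0),\sin(u+\theta_0))$ for a constant $\theta_0$, and $\rho_\pm$ are smooth (extended signed radii of curvature, possibly vanishing). Prime denotes $d/du$. The Wigner caustic branch is the locus of midpoints of the chords; the centre symmetry set branch is the envelope of the chord lines $\gamma_-(u)+\lambda\Delta_\gamma(u)$, parametrised by $S$ when $\det(\Delta_\gamma(0),\mathbf e(0))\ne0$ and $\Sigma_\rho(0)\neq0$. A function has a zero of order $m$ at $0$ if its derivatives of orders $<m$ vanish at $0$ and the $m$-th does not (order $0$ means nonvanishing at $0$). A $3/2$-, $4/3$-, $5/4$-, $(5/4;\pm7)$-cusp is a germ that becomes $t\mapsto(t^2,t^3)$, $(t^3,t^4)$, $(t^4,t^5)$, $(t^4,t^5\pm t^7)$, respectively, after smooth diffeomorphism germs in source and target. *)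

theory Defs
  imports "HOL-Analysis.Analysis"
begin

section \<open>Smooth germs\<close>

text \<open>For open \<open>U\<close>: \<open>C_diff_on k U f\<close> says that \<open>f\<close> is of class \<open>C\<^sup>k\<close> on \<open>U\<close>; the recursion
  runs over all directional derivatives, which is adequate in finite dimension.\<close>

primrec C_diff_on :: "nat \<Rightarrow> 'a::real_normed_vector set \<Rightarrow> ('a \<Rightarrow> 'b::real_normed_vector) \<Rightarrow> bool" where
  "C_diff_on 0 U f \<longleftrightarrow> continuous_on U f"
| "C_diff_on (Suc k) U f \<longleftrightarrow> (\<forall>x\<in>U. f differentiable (at x)) \<and>
     (\<forall>v. C_diff_on k U (\<lambda>x. frechet_derivative f (at x) v))"

definition smooth_on :: "'a::real_normed_vector set \<Rightarrow> ('a \<Rightarrow> 'b::real_normed_vector) \<Rightarrow> bool" where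
  "smooth_on U f \<longleftrightarrow> (\<forall>k. C_diff_on k U f)"

text \<open>A germ at \<open>p\<close> is represented by a total function of which only the values near \<open>p\<close> matter.\<close>

definition smooth_germ :: "'a::real_normed_vector \<Rightarrow> ('a \<Rightarrow> 'b::real_normed_vector) \<Rightarrow> bool" where
  "smooth_germ p f \<longleftrightarrow> (\<exists>U. open U \<and> p \<in> U \<and> smooth_on U f)"

definition diffeo_germ :: "'a::real_normed_vector \<Rightarrow> ('a \<Rightarrow> 'b::real_normed_vector) \<Rightarrow> bool" where
  "diffeo_germ p f \<longleftrightarrow> (\<exists>U V g. open U \<and> p \<in> U \<and> open V \<and>
     homeomorphism U V f g \<and> smooth_on U f \<and> smooth_on V g)"

definition zero_of_order :: "nat \<Rightarrow> (real \<Rightarrow> real) \<Rightarrow> bool" where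
  "zero_of_order m f \<longleftrightarrow> (\<forall>k<m. (deriv ^^ k) f 0 = 0) \<and> (deriv ^^ m) f 0 \<noteq> 0"

section \<open>Cusps\<close>

definition regular_at_0 :: "(real \<Rightarrow> real^2) \<Rightarrow> bool" where
  "regular_at_0 f \<longleftrightarrow> smooth_germ 0 f \<and> vector_derivative f (at 0) \<noteq> 0"

text \<open>\<open>f\<close> becomes \<open>g\<close> at parameter \<open>0\<close> after smooth coordinate changes in source and target.\<close>

definition becomes :: "(real \<Rightarrow> real^2) \<Rightarrow> (real \<Rightarrow> real^2) \<Rightarrow> bool" where
  "becomes f g \<longleftrightarrow> smooth_germ 0 f \<and>
     (\<exists>\<phi> \<Psi>. diffeo_germ (0::real) (\<phi> :: real \<Rightarrow> real) \<and> \<phi> 0 = 0 \<and>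
            diffeo_germ (f 0) (\<Psi> :: real^2 \<Rightarrow> real^2) \<and> \<Psi> (f 0) = g 0 \<and>
            (\<forall>\<^sub>F t in nhds 0. \<Psi> (f (\<phi> t)) = g t))"

definition cusp_3_2 :: "(real \<Rightarrow> real^2) \<Rightarrow> bool" where
  "cusp_3_2 f \<longleftrightarrow> becomes f (\<lambda>t. vector [t^2, t^3])"

definition cusp_4_3 :: "(real \<Rightarrow> real^2) \<Rightarrow> bool" where
  "cusp_4_3 f \<longleftrightarrow> becomes f (\<lambda>t. vector [t^3, t^4])"

definition cusp_5_4 :: "(real \<Rightarrow> real^2) \<Rightarrow> bool" where
  "cusp_5_4 f \<longleftrightarrow> becomes f (\<lambda>t. vector [t^4, t^5])"

text \<open>The \<open>(5/4;+7)\<close>- and \<open>(5/4;-7)\<close>-cusps together.\<close>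

definition cusp_5_4_pm7 :: "(real \<Rightarrow> real^2) \<Rightarrow> bool" where
  "cusp_5_4_pm7 f \<longleftrightarrow>
     becomes f (\<lambda>t. vector [t^4, t^5 + t^7]) \<or> becomes f (\<lambda>t. vector [t^4, t^5 - t^7])"

section \<open>Frontals and parallel pairs\<close>

definition det2 :: "real^2 \<Rightarrow> real^2 \<Rightarrow> real" where
  "det2 a b = det (vector [a, b] :: real^2^2)"

definition unit_vec :: "real \<Rightarrow> real^2" where
  "unit_vec \<theta> = vector [cos \<theta>, sin \<theta>]"

definition cooriented_frontal :: "(real \<Rightarrow> real^2) \<Rightarrow> (real \<Rightarrow> real^2) \<Rightarrow> bool" where
  "cooriented_frontal \<gamma> n \<longleftrightarrow> smooth_germ 0 \<gamma> \<and> smooth_germ 0 n \<and>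
     (\<forall>\<^sub>F t in nhds 0. norm (n t) = 1 \<and> vector_derivative \<gamma> (at t) \<bullet> n t = 0)"

definition tangent_lift ::
  "(real \<Rightarrow> real^2) \<Rightarrow> (real \<Rightarrow> real^2) \<Rightarrow> (real \<Rightarrow> real) \<Rightarrow> (real \<Rightarrow> real) \<Rightarrow> bool" where
  "tangent_lift \<gamma> n l \<theta> \<longleftrightarrow> smooth_germ 0 l \<and> smooth_germ 0 \<theta> \<and>
     (\<forall>\<^sub>F t in nhds 0. unit_vec (\<theta> t) \<bullet> n t = 0 \<and> det2 (unit_vec (\<theta> t)) (n t) > 0 \<and>
        vector_derivative \<gamma> (at t) = l t *\<^sub>R unit_vec (\<theta> t))"

definition angularly_regular_frontal ::
  "(real \<Rightarrow> real^2) \<Rightarrow> (real \<Rightarrow> real) \<Rightarrow> (real \<Rightarrow> real) \<Rightarrow> bool" where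
  "angularly_regular_frontal \<gamma> l \<theta> \<longleftrightarrow>
     (\<exists>n. cooriented_frontal \<gamma> n \<and> tangent_lift \<gamma> n l \<theta>) \<and> deriv \<theta> 0 \<noteq> 0"

text \<open>Both germs are parametrised by the angle \<open>u\<close>. The tangent lift of the second one is
  opposite to that of the first, i.e. its tangent angle is shifted by \<open>pi\<close>.\<close>

definition angularly_regular_parallel_pair ::
  "(real \<Rightarrow> real^2) \<Rightarrow> (real \<Rightarrow> real^2) \<Rightarrow> (real \<Rightarrow> real) \<Rightarrow> (real \<Rightarrow> real) \<Rightarrow> real \<Rightarrow> bool" where
  "angularly_regular_parallel_pair \<gamma>p \<gamma>m \<rho>p \<rho>m \<theta>0 \<longleftrightarrow>
     angularly_regular_frontal \<gamma>p \<rho>p (\<lambda>u. u + \<theta>0) \<and>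
     angularly_regular_frontal \<gamma>m \<rho>m (\<lambda>u. u + \<theta>0 + pi)"

definition wigner_caustic :: "(real \<Rightarrow> real^2) \<Rightarrow> (real \<Rightarrow> real^2) \<Rightarrow> real \<Rightarrow> real^2" where
  "wigner_caustic \<gamma>p \<gamma>m u = (1/2) *\<^sub>R (\<gamma>p u + \<gamma>m u)"

definition centre_symmetry ::
  "(real \<Rightarrow> real^2) \<Rightarrow> (real \<Rightarrow> real^2) \<Rightarrow> (real \<Rightarrow> real) \<Rightarrow> (real \<Rightarrow> real) \<Rightarrow> real \<Rightarrow> real^2" where
  "centre_symmetry \<gamma>p \<gamma>m \<rho>p \<rho>m u =
     \<gamma>m u + (\<rho>m u / (\<rho>p u + \<rho>m u)) *\<^sub>R (\<gamma>p u - \<gamma>m u)"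

section \<open>Parallel pairs in terms of the derivative equations\<close>

lemma unit_vec_plus_pi: "unit_vec (x + pi) = - unit_vec x"
  by (simp add: unit_vec_def vec_eq_iff forall_2)

lemma C_diff_on_const: "C_diff_on k U (\<lambda>x. c)"
  by (induction k arbitrary: c) (auto simp: frechet_derivative_const)

lemma C_diff_on_trig:
  "C_diff_on k U (\<lambda>t::real. cos (t + a) *\<^sub>R v + sin (t + a) *\<^sub>R (w :: real^2))"
proof (induction k arbitrary: v w)
  case 0
  show ?case by (auto intro!: continuous_intros)
next
  case (Suc k)
  have D: "((\<lambda>t::real. cos (t + a) *\<^sub>R v + sin (t + a) *\<^sub>R w) has_derivative
      (\<lambda>h. (- h * sin (x + a)) *\<^sub>R v + (h * cos (x + a)) *\<^sub>R w)) (at x)" for x v w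
    by (auto intro!: derivative_eq_intros simp: algebra_simps)
  have "frechet_derivative (\<lambda>t::real. cos (t + a) *\<^sub>R v + sin (t + a) *\<^sub>R w) (at x) h =
      cos (x + a) *\<^sub>R (h *\<^sub>R w) + sin (x + a) *\<^sub>R ((- h) *\<^sub>R v)" for x h
    by (subst frechet_derivative_at[OF D, symmetric]) (simp add: algebra_simps)
  then have "C_diff_on k U
      (\<lambda>x. frechet_derivative (\<lambda>t. cos (t + a) *\<^sub>R v + sin (t + a) *\<^sub>R w) (at x) h)" for h
    by (simp only: Suc)
  then show ?case unfolding C_diff_on.simps differentiable_def using D by blast
qed

lemma smooth_germ_shift: "smooth_germ p (\<lambda>t::real. t + a)"
proof -
  have D: "((\<lambda>t::real. t + a) has_derivative (\<lambda>h. h)) (at x)" for x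
    by (auto intro!: derivative_eq_intros)
  have "frechet_derivative (\<lambda>t::real. t + a) (at x) = (\<lambda>h. h)" for x
    by (rule frechet_derivative_at[OF D, symmetric])
  then have "C_diff_on k UNIV (\<lambda>t::real. t + a)" for k
    using D by (cases k) (auto intro!: continuous_intros C_diff_on_const simp: differentiable_def)
  then show ?thesis by (auto simp: smooth_germ_def smooth_on_def)
qed

lemma angularly_regular_frontal_shift_iff:
  "angularly_regular_frontal \<gamma> l (\<lambda>u. u + a) \<longleftrightarrow> smooth_germ 0 \<gamma> \<and> smooth_germ 0 l \<and>
     (\<forall>\<^sub>F u in nhds 0. vector_derivative \<gamma> (at u) = l u *\<^sub>R unit_vec (u + a))" (is "?L \<longleftrightarrow> ?R")
proof
  assume ?L
  then show ?R
    unfolding angularly_regular_frontal_def cooriented_frontal_def tangent_lift_def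
    by (auto elim: eventually_mono)
next
  assume R: ?R
  define n :: "real \<Rightarrow> real^2" where "n = (\<lambda>u. vector [- sin (u + a), cos (u + a)])"
  have "n = (\<lambda>t. cos (t + a) *\<^sub>R vector [0, 1] + sin (t + a) *\<^sub>R vector [-1, 0])"
    by (simp add: n_def vec_eq_iff forall_2 fun_eq_iff)
  then have n: "smooth_germ 0 n"
    unfolding smooth_germ_def smooth_on_def using C_diff_on_trig open_UNIV by blast
  have norm: "norm (n t) = 1" for t
    by (simp add: n_def norm_eq_1 inner_vec_def sum_2 flip: power2_eq_square)
  have orth: "unit_vec (t + a) \<bullet> n t = 0" for t
    by (simp add: n_def unit_vec_def inner_vec_def sum_2)
  have pos: "det2 (unit_vec (t + a)) (n t) > 0" for t
    by (simp add: n_def unit_vec_def det2_def det_2 flip: power2_eq_square)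
  have "deriv (\<lambda>u::real. u + a) 0 = 1"
    by (rule DERIV_imp_deriv) (auto intro!: derivative_eq_intros)
  moreover have "cooriented_frontal \<gamma> n"
    using R n norm orth unfolding cooriented_frontal_def
    by (auto elim!: eventually_mono)
  moreover have "tangent_lift \<gamma> n l (\<lambda>u. u + a)"
    using R orth pos smooth_germ_shift unfolding tangent_lift_def by auto
  ultimately show ?L
    unfolding angularly_regular_frontal_def by auto
qed

lemma angularly_regular_parallel_pair_iff:
  "angularly_regular_parallel_pair \<gamma>p \<gamma>m \<rho>p \<rho>m \<theta>0 \<longleftrightarrow>
     smooth_germ 0 \<gamma>p \<and> smooth_germ 0 \<gamma>m \<and> smooth_germ 0 \<rho>p \<and> smooth_germ 0 \<rho>m \<and>
     (\<forall>\<^sub>F u in nhds 0. vector_derivative \<gamma>p (at u) = \<rho>p u *\<^sub>R unit_vec (u + \<theta>0)) \<and>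
     (\<forall>\<^sub>F u in nhds 0. vector_derivative \<gamma>m (at u) = - \<rho>m u *\<^sub>R unit_vec (u + \<theta>0))"
  unfolding angularly_regular_parallel_pair_def add.assoc[of _ \<theta>0 pi]
    angularly_regular_frontal_shift_iff
  by (auto simp: unit_vec_plus_pi simp flip: add.assoc)

end

theory Submission
  imports Defs
begin

text \<open>The derivatives are \<open>E' = (\<Delta>\<^sub>\<rho> / 2) e\<close> and
  \<open>S' = (J / \<Sigma>\<^sub>\<rho>\<^sup>2) \<Delta>\<^sub>\<gamma>\<close>, where
  \<open>\<Delta>\<^sub>\<gamma>' = \<Sigma>\<^sub>\<rho> e\<close> is transverse to
  \<open>\<Delta>\<^sub>\<gamma>\<close>. A cusp of \<open>E\<close> with leading exponent \<open>k\<close> means that the distance of \<open>E u\<close> from \<open>E 0\<close>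
  is comparable to \<open>u\<^sup>k\<close>, as coordinate changes preserve this; hence \<open>\<Delta>\<^sub>\<rho>\<close>
  has a zero of order \<open>k - 1\<close> and \<open>J\<close> one of order \<open>k - 2\<close>, so that \<open>S\<close> has leading exponents
  \<open>k - 1\<close> and \<open>k\<close> in two independent directions.

  For \<open>k = 3\<close> and \<open>k = 4\<close> such a curve is reparametrised so that the coordinate with exponent \<open>3\<close>
  becomes \<open>t\<^sup>3\<close>. The other one is then \<open>t\<^sup>n R(t)\<close> with \<open>n = 2\<close> or \<open>n = 4\<close>. Dividing \<open>R\<close>, as
  in the Malgrange preparation theorem, into \<open>r\<^sub>0(t\<^sup>3) + t r\<^sub>1(t\<^sup>3) + t\<^sup>2 r\<^sub>2(t\<^sup>3)\<close> exhibits it as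
  a quadratic polynomial in \<open>w = t\<^sup>n\<close> with coefficients depending smoothly on \<open>z = t\<^sup>3\<close>, and
  the quadratic formula yields the coordinate change that straightens it.\<close>

section \<open>Calculus of smooth functions\<close>

text \<open>On an open set every derivative sees only nearby values. Differentiability is
  transferred before derivatives are compared, since \<open>frechet_derivative\<close> is a choice
  operator that is meaningful only where a derivative exists.\<close>

lemma C_diff_on_cong:
  assumes "open U" "\<And>x. x \<in> U \<Longrightarrow> f x = g x"
  shows "C_diff_on k U f \<longleftrightarrow> C_diff_on k U g"
  using assms(2)
proof (induction k arbitrary: f g)
  case 0
  then show ?case by (simp cong: continuous_on_cong)
next
  case (Suc k)
  have diff: "f differentiable (at x) \<longleftrightarrow> g differentiable (at x)" if "x \<in> U" for x
    unfolding differentiable_def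
    using has_derivative_transform_within_open[OF _ \<open>open U\<close> that] Suc.prems by metis
  show ?case
  proof (simp only: C_diff_on.simps, intro conj_cong ball_cong refl iff_allI, goal_cases)
    case (1 x)
    then show ?case by (rule diff)
  next
    case (2 v)
    show ?case
    proof (rule Suc.IH)
      show "frechet_derivative f (at x) v = frechet_derivative g (at x) v" if "x \<in> U" for x
        using 2 diff[OF that] that frechet_derivative_transform_within_open[OF _ \<open>open U\<close> that, of f g] Suc.prems
        by simp
    qed
  qed
qed

lemma C_diff_on_subset: "C_diff_on k U f \<Longrightarrow> V \<subseteq> U \<Longrightarrow> C_diff_on k V f"
  by (induction k arbitrary: f) (auto intro: continuous_on_subset)

text \<open>The definition speaks of \<open>frechet_derivative\<close>, a choice; here any explicit
  derivative valid on \<open>U\<close> takes its place. Most inductions on the class below go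
  through this rule.\<close>

lemma C_diff_on_SucI:
  assumes "open U" "\<And>x. x \<in> U \<Longrightarrow> (f has_derivative f' x) (at x)"
    and "\<And>v. C_diff_on k U (\<lambda>x. f' x v)"
  shows "C_diff_on (Suc k) U f"
proof -
  have "frechet_derivative f (at x) = f' x" if "x \<in> U" for x
    using frechet_derivative_at[OF assms(2)[OF that]] by simp
  then have "C_diff_on k U (\<lambda>x. frechet_derivative f (at x) v)" for v
    using C_diff_on_cong[OF assms(1), of "\<lambda>x. frechet_derivative f (at x) v" "\<lambda>x. f' x v" k]
      assms(3)[of v] by simp
  then show ?thesis using assms(2) by (auto simp: differentiable_def)
qed

lemma C_diff_on_Suc_frechet_derivative:
  assumes "C_diff_on (Suc k) U f"
  shows "x \<in> U \<Longrightarrow> (f has_derivative frechet_derivative f (at x)) (at x)"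
    and "C_diff_on k U (\<lambda>x. frechet_derivative f (at x) v)"
  using assms frechet_derivative_works by auto

lemma C_diff_on_SucD: "C_diff_on (Suc k) U f \<Longrightarrow> C_diff_on k U f"
proof (induction k arbitrary: f)
  case 0
  then show ?case
    by (auto intro!: continuous_at_imp_continuous_on differentiable_imp_continuous_within)
next
  case (Suc k)
  show ?case
    unfolding C_diff_on.simps(2)[of k]
    using Suc.prems unfolding C_diff_on.simps(2)[of "Suc k"] by (blast intro: Suc.IH)
qed

lemma C_diff_on_continuous_on: "C_diff_on k U f \<Longrightarrow> continuous_on U f"
proof (induction k)
  case (Suc k)
  from C_diff_on_SucD[OF Suc.prems] show ?case by (rule Suc.IH)
qed simp

lemma C_diff_on_add:
  assumes "open U" "C_diff_on k U f" "C_diff_on k U g"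
  shows "C_diff_on k U (\<lambda>x. f x + g x)"
  using assms(2,3)
proof (induction k arbitrary: f g)
  case 0
  then show ?case by (simp add: continuous_on_add)
next
  case (Suc k)
  define f' where "f' = (\<lambda>x. frechet_derivative f (at x))"
  note f' = C_diff_on_Suc_frechet_derivative[OF Suc.prems(1), folded f'_def[THEN fun_cong]]
  define g' where "g' = (\<lambda>x. frechet_derivative g (at x))"
  note g' = C_diff_on_Suc_frechet_derivative[OF Suc.prems(2), folded g'_def[THEN fun_cong]]
  show ?case
  proof (rule C_diff_on_SucI[OF assms(1)])
    show "((\<lambda>x. f x + g x) has_derivative (\<lambda>v. f' x v + g' x v)) (at x)" if "x \<in> U" for x
      using f'(1)[OF that] g'(1)[OF that] by (rule has_derivative_add)
    show "C_diff_on k U (\<lambda>x. f' x v + g' x v)" for v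
      by (intro Suc.IH f'(2) g'(2))
  qed
qed

text \<open>By the product rule the derivative is a sum of two products of the same kind, in each of
  which one factor stays undifferentiated; \<open>C_diff_on_SucD\<close> lowers the class of that
  factor so that the induction hypothesis applies.\<close>

lemma C_diff_on_bilinear:
  assumes "bounded_bilinear B" "open U" "C_diff_on k U f" "C_diff_on k U g"
  shows "C_diff_on k U (\<lambda>x. B (f x) (g x))"
  using assms(3,4)
proof (induction k arbitrary: f g)
  case 0
  then show ?case by (simp add: bounded_bilinear.continuous_on[OF assms(1)])
next
  case (Suc k)
  define f' where "f' = (\<lambda>x. frechet_derivative f (at x))"
  note f' = C_diff_on_Suc_frechet_derivative[OF Suc.prems(1), folded f'_def[THEN fun_cong]]
  define g' where "g' = (\<lambda>x. frechet_derivative g (at x))"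
  note g' = C_diff_on_Suc_frechet_derivative[OF Suc.prems(2), folded g'_def[THEN fun_cong]]
  note fg = Suc.prems[THEN C_diff_on_SucD]
  show ?case
  proof (rule C_diff_on_SucI[OF assms(2)])
    show "((\<lambda>x. B (f x) (g x)) has_derivative (\<lambda>v. B (f x) (g' x v) + B (f' x v) (g x))) (at x)"
      if "x \<in> U" for x
      using f'(1)[OF that] g'(1)[OF that] by (rule bounded_bilinear.FDERIV[OF assms(1)])
    show "C_diff_on k U (\<lambda>x. B (f x) (g' x v) + B (f' x v) (g x))" for v
      by (intro C_diff_on_add assms(2) Suc.IH fg f'(2) g'(2))
  qed
qed

lemma C_diff_on_linear:
  assumes "bounded_linear L" "open U" "C_diff_on k U f"
  shows "C_diff_on k U (\<lambda>x. L (f x))"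
  using assms(3)
proof (induction k arbitrary: f)
  case 0
  then show ?case by (simp add: bounded_linear.continuous_on[OF assms(1)])
next
  case (Suc k)
  define f' where "f' = (\<lambda>x. frechet_derivative f (at x))"
  note f' = C_diff_on_Suc_frechet_derivative[OF Suc.prems(1), folded f'_def[THEN fun_cong]]
  show ?case
  proof (rule C_diff_on_SucI[OF assms(2)])
    show "((\<lambda>x. L (f x)) has_derivative (\<lambda>v. L (f' x v))) (at x)" if "x \<in> U" for x
      using f'(1)[OF that] by (rule bounded_linear.has_derivative[OF assms(1)])
    show "C_diff_on k U (\<lambda>x. L (f' x v))" for v
      by (intro Suc.IH f'(2))
  qed
qed

lemma C_diff_on_sum:
  assumes "open U" "\<And>i. i \<in> I \<Longrightarrow> C_diff_on k U (f i)"
  shows "C_diff_on k U (\<lambda>x. \<Sum>i\<in>I. f i x)"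
  using assms(2)
proof (induction I rule: infinite_finite_induct)
  case (insert i I)
  have "C_diff_on k U (\<lambda>x. f i x + (\<Sum>i\<in>I. f i x))"
    by (intro C_diff_on_add assms(1) insert.IH insert.prems) auto
  with insert.hyps show ?case by simp
qed (simp_all add: C_diff_on_const)

text \<open>In the chain rule the direction \<open>f' x v\<close> in which \<open>g\<close> is
  differentiated moves with \<open>x\<close>, whereas the definition controls fixed directions.
  Expanding it in a basis, hence the Euclidean middle space, reduces to finitely many fixed
  directions.\<close>

lemma C_diff_on_compose:
  fixes f :: "'a::real_normed_vector \<Rightarrow> 'b::euclidean_space" and g :: "'b \<Rightarrow> 'c::real_normed_vector"
  assumes "open U" "open V" "f ` U \<subseteq> V" "C_diff_on k U f" "C_diff_on k V g"
  shows "C_diff_on k U (\<lambda>x. g (f x))"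
  using assms(4,5)
proof (induction k arbitrary: g)
  case 0
  then show ?case using assms(3) by (auto intro: continuous_on_compose2)
next
  case (Suc k)
  define f' where "f' = (\<lambda>x. frechet_derivative f (at x))"
  note f' = C_diff_on_Suc_frechet_derivative[OF Suc.prems(1), folded f'_def[THEN fun_cong]]
  define g' where "g' = (\<lambda>x. frechet_derivative g (at x))"
  note g' = C_diff_on_Suc_frechet_derivative[OF Suc.prems(2), folded g'_def[THEN fun_cong]]
  have fk: "C_diff_on k U f"
    using Suc.prems(1) by (rule C_diff_on_SucD)
  define h where "h = (\<lambda>x v. \<Sum>i\<in>Basis. (f' x v \<bullet> i) *\<^sub>R g' (f x) i)"
  have h: "h x = (\<lambda>v. g' (f x) (f' x v))" if "x \<in> U" for x
  proof
    fix v
    have lin: "linear (g' (f x))"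
      using g'(1)[of "f x"] that assms(3) has_derivative_linear by blast
    have "g' (f x) (f' x v) = g' (f x) (\<Sum>i\<in>Basis. (f' x v \<bullet> i) *\<^sub>R i)"
      by (simp add: euclidean_representation)
    also have "\<dots> = h x v"
      unfolding h_def linear_sum[OF lin] linear_cmul[OF lin] ..
    finally show "h x v = g' (f x) (f' x v)" ..
  qed
  have D: "((\<lambda>x. g (f x)) has_derivative h x) (at x)" if "x \<in> U" for x
    unfolding h[OF that] by (rule has_derivative_compose[OF f'(1) g'(1)]) (use that assms(3) in auto)
  show ?case
  proof (rule C_diff_on_SucI[OF assms(1) D])
    show "C_diff_on k U (\<lambda>x. h x v)" for v
      unfolding h_def
      by (intro C_diff_on_sum assms(1) C_diff_on_bilinear[OF bounded_bilinear_scaleR]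
          C_diff_on_linear[OF bounded_linear_inner_left] f'(2) Suc.IH fk g'(2))
  qed
qed

section \<open>Algebra of smooth functions\<close>

lemma smooth_onD: "smooth_on U f \<Longrightarrow> C_diff_on k U f"
  by (simp add: smooth_on_def)

lemma smooth_on_continuous_on: "smooth_on U f \<Longrightarrow> continuous_on U f"
  using smooth_onD C_diff_on_continuous_on by blast

lemma smooth_on_subset: "smooth_on U f \<Longrightarrow> V \<subseteq> U \<Longrightarrow> smooth_on V f"
  by (auto simp: smooth_on_def intro: C_diff_on_subset)

lemma smooth_on_cong:
  "open U \<Longrightarrow> (\<And>x. x \<in> U \<Longrightarrow> f x = g x) \<Longrightarrow> smooth_on U f \<longleftrightarrow> smooth_on U g"
  by (simp add: smooth_on_def C_diff_on_cong[of U f g])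

lemma smooth_on_const: "smooth_on U (\<lambda>x. c)"
  by (simp add: smooth_on_def C_diff_on_const)

lemma smooth_on_add:
  "open U \<Longrightarrow> smooth_on U f \<Longrightarrow> smooth_on U g \<Longrightarrow> smooth_on U (\<lambda>x. f x + g x)"
  by (simp add: smooth_on_def C_diff_on_add)

lemma smooth_on_bilinear:
  "bounded_bilinear B \<Longrightarrow> open U \<Longrightarrow> smooth_on U f \<Longrightarrow> smooth_on U g \<Longrightarrow>
    smooth_on U (\<lambda>x. B (f x) (g x))"
  by (simp add: smooth_on_def C_diff_on_bilinear)

lemma smooth_on_linear:
  "bounded_linear L \<Longrightarrow> open U \<Longrightarrow> smooth_on U f \<Longrightarrow> smooth_on U (\<lambda>x. L (f x))"
  by (simp add: smooth_on_def C_diff_on_linear)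

lemmas smooth_on_scaleR = smooth_on_bilinear[OF bounded_bilinear_scaleR]
  and smooth_on_mult = smooth_on_bilinear[OF bounded_bilinear_mult]
  and smooth_on_inner = smooth_on_bilinear[OF bounded_bilinear_inner]
  and smooth_on_minus = smooth_on_linear[OF bounded_linear_minus[OF bounded_linear_ident]]
  and smooth_on_vec_nth = smooth_on_linear[OF bounded_linear_vec_nth]

lemma smooth_on_diff:
  "open U \<Longrightarrow> smooth_on U f \<Longrightarrow> smooth_on U g \<Longrightarrow> smooth_on U (\<lambda>x. f x - g x)"
  using smooth_on_add[of U f "\<lambda>x. - g x"] smooth_on_minus[of U g] by simp

lemma smooth_on_compose:
  fixes f :: "'a::real_normed_vector \<Rightarrow> 'b::euclidean_space"
  shows "smooth_on V g \<Longrightarrow> open V \<Longrightarrow> open U \<Longrightarrow> smooth_on U f \<Longrightarrow> (\<And>x. x \<in> U \<Longrightarrow> f x \<in> V) \<Longrightarrow>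
    smooth_on U (\<lambda>x. g (f x))"
  by (auto simp: smooth_on_def intro!: C_diff_on_compose[of U V f _ g])

lemma smooth_on_ident: "open U \<Longrightarrow> smooth_on U (\<lambda>x. x)"
  unfolding smooth_on_def
proof (rule allI)
  show "C_diff_on k U (\<lambda>x. x)" if "open U" for k
  proof (cases k)
    case (Suc k)
    show ?thesis unfolding Suc
      by (rule C_diff_on_SucI[OF that, where f' = "\<lambda>x v. v"]) (auto intro: C_diff_on_const)
  qed simp
qed

lemma smooth_on_power:
  fixes f :: "'a::real_normed_vector \<Rightarrow> real"
  shows "open U \<Longrightarrow> smooth_on U f \<Longrightarrow> smooth_on U (\<lambda>x. f x ^ n)"
  by (induction n) (auto intro: smooth_on_const smooth_on_mult)

section \<open>Functions of one real variable\<close>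

lemma C_diff_on_SucI_vector:
  fixes f :: "real \<Rightarrow> 'a::real_normed_vector"
  assumes "open U" "\<And>x. x \<in> U \<Longrightarrow> (f has_vector_derivative f' x) (at x)" "C_diff_on k U f'"
  shows "C_diff_on (Suc k) U f"
  using assms
  by (intro C_diff_on_SucI[where f' = "\<lambda>x v. v *\<^sub>R f' x"]
      C_diff_on_bilinear[OF bounded_bilinear_scaleR] C_diff_on_const)
    (auto simp: has_vector_derivative_def)

lemma C_diff_on_SucI_real:
  fixes f :: "real \<Rightarrow> real"
  assumes "open U" "\<And>x. x \<in> U \<Longrightarrow> (f has_real_derivative f' x) (at x)" "C_diff_on k U f'"
  shows "C_diff_on (Suc k) U f"
  using assms by (intro C_diff_on_SucI_vector) (auto simp: has_real_derivative_iff_has_vector_derivative)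

lemma C_diff_on_Suc_vector_derivative:
  fixes f :: "real \<Rightarrow> 'a::real_normed_vector"
  assumes "open U" "C_diff_on (Suc k) U f"
  shows "x \<in> U \<Longrightarrow> (f has_vector_derivative vector_derivative f (at x)) (at x)"
    and "C_diff_on k U (\<lambda>x. vector_derivative f (at x))"
proof -
  show *: "(f has_vector_derivative vector_derivative f (at x)) (at x)" if "x \<in> U" for x
    using assms(2) that by (simp add: vector_derivative_works)
  have "frechet_derivative f (at x) 1 = vector_derivative f (at x)" if "x \<in> U" for x
    using frechet_derivative_at[OF *[OF that, unfolded has_vector_derivative_def], symmetric] by simp
  then show "C_diff_on k U (\<lambda>x. vector_derivative f (at x))"
    using C_diff_on_Suc_frechet_derivative(2)[OF assms(2), of 1]
      C_diff_on_cong[OF assms(1), of "\<lambda>x. frechet_derivative f (at x) 1"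
        "\<lambda>x. vector_derivative f (at x)" k] by simp
qed

lemma smooth_on_has_vector_derivative:
  fixes f :: "real \<Rightarrow> 'a::real_normed_vector"
  assumes "open U" "smooth_on U f" "x \<in> U"
  shows "(f has_vector_derivative vector_derivative f (at x)) (at x)"
  using C_diff_on_Suc_vector_derivative(1)[OF assms(1) smooth_onD[OF assms(2)] assms(3)] .

lemma smooth_on_vector_derivative:
  fixes f :: "real \<Rightarrow> 'a::real_normed_vector"
  shows "open U \<Longrightarrow> smooth_on U f \<Longrightarrow> smooth_on U (\<lambda>x. vector_derivative f (at x))"
  unfolding smooth_on_def by (blast intro: C_diff_on_Suc_vector_derivative(2))

lemma smooth_on_has_real_derivative:
  fixes f :: "real \<Rightarrow> real"
  assumes "open U" "smooth_on U f" "x \<in> U"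
  shows "(f has_real_derivative deriv f x) (at x)"
  using smooth_on_has_vector_derivative[OF assms]
  by (metis DERIV_imp_deriv has_real_derivative_iff_has_vector_derivative)

lemma smooth_on_deriv:
  fixes f :: "real \<Rightarrow> real"
  assumes "open U" "smooth_on U f"
  shows "smooth_on U (deriv f)"
proof -
  have "deriv f x = vector_derivative f (at x)" if "x \<in> U" for x
    using smooth_on_has_vector_derivative[OF assms that]
    by (metis DERIV_imp_deriv has_real_derivative_iff_has_vector_derivative)
  then show ?thesis
    using smooth_on_vector_derivative[OF assms]
      smooth_on_cong[OF assms(1), of "deriv f" "\<lambda>x. vector_derivative f (at x)"] by simp
qed

section \<open>Powers, reciprocals and trigonometric functions\<close>

lemma smooth_on_powr:
  fixes f :: "'a::real_normed_vector \<Rightarrow> real"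
  assumes "open U" "smooth_on U f" "\<And>x. x \<in> U \<Longrightarrow> f x > 0"
  shows "smooth_on U (\<lambda>x. f x powr a)"
proof -
  \<comment> \<open>The claim carries a coefficient and an arbitrary exponent because the derivative
    of \<open>c * x powr a\<close> is \<open>c * a * x powr (a - 1)\<close>.\<close>
  have "C_diff_on k {0<..} (\<lambda>x::real. c * x powr a)" for k c a
  proof (induction k arbitrary: c a)
    case 0
    show ?case by (auto intro!: continuous_intros)
  next
    case (Suc k)
    show ?case
      by (rule C_diff_on_SucI_real[OF _ _ Suc[of "c * a" "a - 1"]])
        (auto intro!: derivative_eq_intros)
  qed
  from this[of _ 1] have "smooth_on {0<..} (\<lambda>x::real. x powr a)"
    by (simp add: smooth_on_def)
  from smooth_on_compose[OF this _ assms(1,2)] assms(3) show ?thesis by (simp add: open_Compl)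
qed

lemma smooth_on_inverse:
  fixes f :: "'a::real_normed_vector \<Rightarrow> real"
  assumes "open U" "smooth_on U f" "\<And>x. x \<in> U \<Longrightarrow> f x \<noteq> 0"
  shows "smooth_on U (\<lambda>x. inverse (f x))"
proof -
  have "C_diff_on k (- {0}) (inverse :: real \<Rightarrow> real)" for k
  proof (induction k)
    case 0
    show ?case by (auto intro!: continuous_intros)
  next
    case (Suc k)
    \<comment> \<open>The derivative of the reciprocal is a polynomial in the reciprocal, so class
      \<open>k\<close> of the function gives class \<open>k\<close> of its derivative.\<close>
    have "C_diff_on k (- {0}) (\<lambda>x::real. - (inverse x * inverse x))"
      by (intro C_diff_on_linear[OF bounded_linear_minus[OF bounded_linear_ident]]
          C_diff_on_bilinear[OF bounded_bilinear_mult] Suc) auto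
    then show ?case
      by (rule C_diff_on_SucI_real[rotated 2]) (auto intro!: derivative_eq_intros)
  qed
  then have "smooth_on (- {0}) (inverse :: real \<Rightarrow> real)"
    by (simp add: smooth_on_def)
  from smooth_on_compose[OF this _ assms(1,2)] assms(3) show ?thesis by (simp add: open_Compl)
qed

lemma smooth_on_divide:
  fixes f g :: "'a::real_normed_vector \<Rightarrow> real"
  assumes "open U" "smooth_on U f" "smooth_on U g" "\<And>x. x \<in> U \<Longrightarrow> g x \<noteq> 0"
  shows "smooth_on U (\<lambda>x. f x / g x)"
  using smooth_on_mult[OF assms(1,2) smooth_on_inverse[OF assms(1,3,4)]]
  by (simp add: divide_inverse)

lemma smooth_on_cos: "smooth_on U (\<lambda>t::real. cos (t + a))"
  and smooth_on_sin: "smooth_on U (\<lambda>t::real. sin (t + a))"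
proof -
  have *: "smooth_on UNIV (\<lambda>t::real. cos (t + a) *\<^sub>R v + sin (t + a) *\<^sub>R (w :: real^2))" for v w
    by (simp add: smooth_on_def C_diff_on_trig)
  show "smooth_on U (\<lambda>t::real. cos (t + a))"
    using smooth_on_vec_nth[OF open_UNIV *[of "vector [1, 0]" 0], of 1]
    by (auto intro: smooth_on_subset)
  show "smooth_on U (\<lambda>t::real. sin (t + a))"
    using smooth_on_vec_nth[OF open_UNIV *[of 0 "vector [1, 0]"], of 1]
    by (auto intro: smooth_on_subset)
qed

lemmas smooth_on_intros = smooth_on_const smooth_on_ident smooth_on_add smooth_on_diff
  smooth_on_minus smooth_on_mult smooth_on_scaleR smooth_on_inner smooth_on_power
  smooth_on_divide smooth_on_powr smooth_on_vec_nth smooth_on_deriv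

section \<open>Taylor expansion with smooth remainder\<close>

text \<open>Differentiation under the integral sign produces a factor \<open>t\<close>, so the
  weight \<open>t ^ n\<close> has to be general: the step passes from \<open>f\<close> and
  \<open>n\<close> to the derivative of \<open>f\<close> and \<open>Suc n\<close>.\<close>

lemma C_diff_on_integral_dilation:
  fixes f :: "real \<Rightarrow> 'a::banach"
  assumes "C_diff_on k (ball 0 e) f"
  shows "C_diff_on k (ball 0 e) (\<lambda>x. integral {0..1} (\<lambda>t. t ^ n *\<^sub>R f (t * x)))"
  using assms
proof (induction k arbitrary: f n)
  have in_ball: "t * x \<in> ball 0 e" if "x \<in> ball 0 e" "t \<in> {0..1}" for x t :: real
    using that mult_mono[of "\<bar>t\<bar>" 1 "\<bar>x\<bar>" "\<bar>x\<bar>"] by (auto simp: abs_mult)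
  have cont: "continuous_on (ball 0 e \<times> cbox 0 1) (\<lambda>(x, t). t ^ n *\<^sub>R g (t * x))"
    if "continuous_on (ball 0 e) g" for g :: "real \<Rightarrow> 'a" and n
    unfolding split_beta using in_ball
    by (intro continuous_intros continuous_on_compose2[OF that]) auto
  {
    case 0
    then show ?case
      using integral_continuous_on_param[OF cont[of f n]] by simp
  next
    case (Suc k)
    let ?f' = "\<lambda>x. vector_derivative f (at x)"
    note f' = C_diff_on_Suc_vector_derivative[OF open_ball Suc.prems]
    have cf: "continuous_on (ball 0 e) f" and cf': "continuous_on (ball 0 e) ?f'"
      by (rule C_diff_on_continuous_on[OF Suc.prems], rule C_diff_on_continuous_on[OF f'(2)])
    show ?case
    proof (rule C_diff_on_SucI_vector[OF open_ball _ Suc.IH[OF f'(2), of "Suc n"]])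
      fix x :: real
      assume x: "x \<in> ball 0 e"
      have "((\<lambda>x. integral (cbox 0 1) (\<lambda>t. t ^ n *\<^sub>R f (t * x))) has_vector_derivative
          integral (cbox 0 1) (\<lambda>t. t ^ Suc n *\<^sub>R ?f' (t * x))) (at x within ball 0 e)"
      proof (rule leibniz_rule_vector_derivative[OF _ _ cont[OF cf'] x convex_ball])
        fix y t :: real
        assume y: "y \<in> ball 0 e" and t: "t \<in> cbox 0 1"
        have "((\<lambda>x. f (t * x)) has_vector_derivative t *\<^sub>R ?f' (t * y)) (at y)"
          using vector_diff_chain_at[of "\<lambda>x. t * x" t y f "?f' (t * y)"] f'(1)[OF in_ball[OF y]] t
          by (simp add: o_def has_real_derivative_iff_has_vector_derivative[symmetric]
              DERIV_cmult_Id)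
        from has_vector_derivative_at_within[OF bounded_linear.has_vector_derivative[OF
            bounded_linear_scaleR_right[of "t ^ n"] this]]
        show "((\<lambda>x. t ^ n *\<^sub>R f (t * x)) has_vector_derivative
            t ^ Suc n *\<^sub>R ?f' (t * y)) (at y within ball 0 e)"
          by (simp add: mult.commute)
      next
        fix y :: real
        assume y: "y \<in> ball 0 e"
        show "(\<lambda>t. t ^ n *\<^sub>R f (t * y)) integrable_on cbox 0 1"
          using y in_ball
          by (intro integrable_continuous continuous_intros continuous_on_compose2[OF cf]) auto
      qed
      then show "((\<lambda>x. integral {0..1} (\<lambda>t. t ^ n *\<^sub>R f (t * x))) has_vector_derivative
          integral {0..1} (\<lambda>t. t ^ Suc n *\<^sub>R ?f' (t * x))) (at x)"
        by (simp add: at_within_open[OF x open_ball])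
    qed
  }
qed

text \<open>A weighted form of Hadamard's lemma. Substituting \<open>s = t * x\<close> in the
  integral of \<open>s ^ n *\<^sub>R \<alpha> s\<close> from 0 to \<open>x\<close> pulls out
  \<open>x ^ Suc n\<close> and leaves an integral over a fixed interval, which depends smoothly on
  \<open>x\<close>.\<close>

lemma antiderivative_factor:
  fixes f :: "real \<Rightarrow> 'a::banach"
  assumes "0 < e" "smooth_on (ball 0 e) \<alpha>"
    and f: "\<And>x. x \<in> ball 0 e \<Longrightarrow> (f has_vector_derivative x ^ n *\<^sub>R \<alpha> x) (at x)"
  obtains \<beta> where "smooth_on (ball 0 e) \<beta>"
    "\<And>x. x \<in> ball 0 e \<Longrightarrow> f x = f 0 + x ^ Suc n *\<^sub>R \<beta> x" "\<beta> 0 = \<alpha> 0 /\<^sub>R real (Suc n)"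
proof
  let ?\<beta> = "\<lambda>x. integral {0..1} (\<lambda>t. t ^ n *\<^sub>R \<alpha> (t * x))"
  show "smooth_on (ball 0 e) ?\<beta>"
    unfolding smooth_on_def by (intro allI C_diff_on_integral_dilation smooth_onD assms(2))
  show "f x = f 0 + x ^ Suc n *\<^sub>R ?\<beta> x" if x: "x \<in> ball 0 e" for x
  proof -
    have "((\<lambda>t. x ^ Suc n *\<^sub>R t ^ n *\<^sub>R \<alpha> (t * x)) has_integral f (1 * x) - f (0 * x)) {0..1}"
    proof (rule fundamental_theorem_of_calculus)
      fix t :: real
      assume t: "t \<in> {0..1}"
      have "t * x \<in> ball 0 e"
        using x t mult_mono[of "\<bar>t\<bar>" 1 "\<bar>x\<bar>" "\<bar>x\<bar>"] by (auto simp: abs_mult)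
      from f[OF this] have "((\<lambda>t. f (t * x)) has_vector_derivative x *\<^sub>R ((t * x) ^ n *\<^sub>R \<alpha> (t * x))) (at t)"
        using vector_diff_chain_at[of "\<lambda>t. t * x" x t f "(t * x) ^ n *\<^sub>R \<alpha> (t * x)"] DERIV_cmult_right[OF DERIV_ident, of x]
        by (auto simp: o_def has_real_derivative_iff_has_vector_derivative[symmetric])
      from has_vector_derivative_at_within[OF this]
      show "((\<lambda>t. f (t * x)) has_vector_derivative x ^ Suc n *\<^sub>R t ^ n *\<^sub>R \<alpha> (t * x))
          (at t within {0..1})"
        by (simp add: power_mult_distrib mult_ac)
    qed simp
    from integral_unique[OF this]
    show ?thesis by (simp only: integral_cmul mult_1 mult_zero_left) (simp add: algebra_simps)
  qed
  have "((\<lambda>t. t ^ n *\<^sub>R \<alpha> 0) has_integral (1 ^ Suc n / real (Suc n)) *\<^sub>R \<alpha> 0 - (0 ^ Suc n / real (Suc n)) *\<^sub>R \<alpha> 0) {0..1}"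
  proof (rule fundamental_theorem_of_calculus)
    fix t :: real
    have "((\<lambda>t. t ^ Suc n / real (Suc n)) has_real_derivative t ^ n) (at t within {0..1})"
      by (rule DERIV_cong[OF DERIV_cdivide[OF DERIV_pow]]) simp
    from has_vector_derivative_scaleR[OF this has_vector_derivative_const]
    show "((\<lambda>t. (t ^ Suc n / real (Suc n)) *\<^sub>R \<alpha> 0) has_vector_derivative t ^ n *\<^sub>R \<alpha> 0)
        (at t within {0..1})"
      by simp
  qed simp
  then show "?\<beta> 0 = \<alpha> 0 /\<^sub>R real (Suc n)"
    by (simp add: integral_unique divide_inverse)
qed

text \<open>Expand the derivative to length \<open>n\<close> and integrate, the polynomial termwise
  and the remainder by \<open>antiderivative_factor\<close>. The value of the remainder at 0, the
  next Taylor coefficient, later shows that quotients do not vanish there.\<close>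

lemma smooth_on_Taylor:
  fixes f :: "real \<Rightarrow> real"
  assumes "0 < e" "smooth_on (ball 0 e) f"
  shows "\<exists>g. smooth_on (ball 0 e) g \<and> g 0 = (deriv ^^ n) f 0 / fact n \<and>
    (\<forall>x\<in>ball 0 e. f x = (\<Sum>k<n. (deriv ^^ k) f 0 / fact k * x ^ k) + x ^ n * g x)"
  using assms(2)
proof (induction n arbitrary: f)
  case (Suc n)
  let ?d = "\<lambda>k. (deriv ^^ k) f 0"
  have d: "(deriv ^^ k) (deriv f) 0 = ?d (Suc k)" for k
    by (simp add: funpow_swap1)
  obtain g where g: "smooth_on (ball 0 e) g" "g 0 = ?d (Suc n) / fact n"
    "\<And>x. x \<in> ball 0 e \<Longrightarrow> deriv f x = (\<Sum>k<n. ?d (Suc k) / fact k * x ^ k) + x ^ n * g x"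
    using Suc.IH[OF smooth_on_deriv[OF open_ball Suc.prems]] unfolding d by blast
  let ?P = "\<lambda>x. \<Sum>k<n. ?d (Suc k) / fact (Suc k) * x ^ Suc k"
  have "((\<lambda>x. f x - ?P x) has_vector_derivative x ^ n *\<^sub>R g x) (at x)" if "x \<in> ball 0 e" for x
  proof -
    have "(?P has_real_derivative (\<Sum>k<n. ?d (Suc k) / fact k * x ^ k)) (at x)"
    proof (rule DERIV_sum)
      show "((\<lambda>x. ?d (Suc k) / fact (Suc k) * x ^ Suc k) has_real_derivative
          ?d (Suc k) / fact k * x ^ k) (at x)" for k
        by (rule DERIV_cong[OF DERIV_cmult[OF DERIV_pow]]) (simp add: field_simps del: of_nat_Suc)
    qed
    from DERIV_diff[OF smooth_on_has_real_derivative[OF open_ball Suc.prems that] this]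
    show ?thesis
      by (simp add: g(3)[OF that] has_real_derivative_iff_has_vector_derivative)
  qed
  from antiderivative_factor[OF assms(1) g(1) this]
  obtain \<beta> where \<beta>: "smooth_on (ball 0 e) \<beta>" "\<beta> 0 = g 0 / real (Suc n)"
    "\<And>x. x \<in> ball 0 e \<Longrightarrow> f x - ?P x = f 0 - ?P 0 + x ^ Suc n * \<beta> x"
    by (auto simp: divide_inverse mult.commute)
  show ?case
  proof (intro exI conjI ballI)
    show "\<beta> 0 = ?d (Suc n) / fact (Suc n)"
      by (simp add: \<beta>(2) g(2) field_simps)
    show "f x = (\<Sum>k<Suc n. ?d k / fact k * x ^ k) + x ^ Suc n * \<beta> x" if "x \<in> ball 0 e" for x
      using \<beta>(3)[OF that] by (simp add: sum.lessThan_Suc_shift del: sum.lessThan_Suc)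
  qed (rule \<beta>(1))
next
  case 0
  then show ?case by (intro exI[of _ f]) simp
qed

text \<open>Differentiating \<open>x ^ Suc n * g x\<close> gives \<open>x ^ n\<close> times a smooth
  function with value \<open>real (Suc n) * g 0\<close> at 0; these factors accumulate to the
  factorial.\<close>

lemma deriv_funpow_eq_0:
  fixes f :: "real \<Rightarrow> real"
  assumes "0 < e" "smooth_on (ball 0 e) g" "\<And>x. x \<in> ball 0 e \<Longrightarrow> f x = x ^ n * g x"
  shows "(\<forall>k<n. (deriv ^^ k) f 0 = 0) \<and> (deriv ^^ n) f 0 = fact n * g 0"
  using assms(2,3)
proof (induction n arbitrary: f g)
  case 0
  then show ?case using assms(1) by simp
next
  case (Suc n)
  let ?g = "\<lambda>x. real (Suc n) * g x + x * deriv g x"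
  have "deriv f x = x ^ n * ?g x" if x: "x \<in> ball 0 e" for x
  proof (rule DERIV_imp_deriv)
    have "((\<lambda>x. x ^ Suc n * g x) has_real_derivative x ^ n * ?g x) (at x)"
      by (rule DERIV_cong[OF DERIV_mult[OF DERIV_pow
            smooth_on_has_real_derivative[OF open_ball Suc.prems(1) x]]]) (simp add: algebra_simps)
    then show "(f has_real_derivative x ^ n * ?g x) (at x)"
      by (rule has_field_derivative_transform_within_open[OF _ open_ball x]) (simp add: Suc.prems(2))
  qed
  moreover have "smooth_on (ball 0 e) ?g"
    by (intro smooth_on_intros Suc.prems open_ball)
  ultimately have *: "\<forall>k<n. (deriv ^^ k) (deriv f) 0 = 0" "(deriv ^^ n) (deriv f) 0 = fact n * ?g 0"
    using Suc.IH[of ?g "deriv f"] by auto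
  have "f 0 = 0" using Suc.prems(2)[of 0] assms(1) by simp
  then have "(deriv ^^ k) f 0 = 0" if "k < Suc n" for k
    using that *(1) by (cases k) (auto simp: funpow_swap1)
  then show ?case using *(2) by (simp add: funpow_swap1)
qed

text \<open>From here on orders of vanishing are handled through smooth quotients. Taylor's
  expansion with vanishing coefficients gives one direction, differentiation of the product the
  other.\<close>

lemma zero_of_order_iff:
  assumes "0 < e" "smooth_on (ball 0 e) f"
  shows "zero_of_order n f \<longleftrightarrow>
    (\<exists>g. smooth_on (ball 0 e) g \<and> g 0 \<noteq> 0 \<and> (\<forall>x\<in>ball 0 e. f x = x ^ n * g x))"
proof
  assume "zero_of_order n f"
  then show "\<exists>g. smooth_on (ball 0 e) g \<and> g 0 \<noteq> 0 \<and> (\<forall>x\<in>ball 0 e. f x = x ^ n * g x)"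
    using smooth_on_Taylor[OF assms, of n] by (auto simp: zero_of_order_def)
next
  assume "\<exists>g. smooth_on (ball 0 e) g \<and> g 0 \<noteq> 0 \<and> (\<forall>x\<in>ball 0 e. f x = x ^ n * g x)"
  then obtain g where g: "smooth_on (ball 0 e) g" "g 0 \<noteq> 0"
    "\<And>x. x \<in> ball 0 e \<Longrightarrow> f x = x ^ n * g x" by blast
  show "zero_of_order n f"
    using deriv_funpow_eq_0[OF assms(1) g(1,3)] g(2) by (simp add: zero_of_order_def)
qed

section \<open>Borel's theorem\<close>

text \<open>The witness is the \<open>n\<close>-fold primitive of \<open>M sin (l x) / l\<close> with \<open>l\<close> large.\<close>

lemma ex_small_derivatives_Suc:
  fixes M \<epsilon> :: real
  assumes "0 < \<epsilon>"
  shows "\<exists>G. (\<forall>k x. (G k has_real_derivative G (Suc k) x) (at x)) \<and> (\<forall>k\<le>n. G k 0 = 0) \<and>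
    G (Suc n) 0 = M \<and> (\<forall>k\<le>n. \<forall>x. \<bar>x\<bar> \<le> 1 \<longrightarrow> \<bar>G k x\<bar> \<le> \<epsilon>)"
proof (induction n)
  case 0
  \<comment> \<open>This size of \<open>l\<close> makes \<open>\<bar>M\<bar> / l\<close>, which
    bounds the function, at most \<open>\<epsilon>\<close>, while the first derivative at 0 is still
    \<open>M\<close>.\<close>
  define l where "l = 1 + \<bar>M\<bar> / \<epsilon>"
  have l: "l > 0" "\<bar>M\<bar> \<le> \<epsilon> * l"
    using assms by (auto simp: l_def field_simps add_pos_nonneg)
  \<comment> \<open>\<open>G k\<close> is the derivative of order \<open>k\<close> of
    \<open>M * sin (l * x) / l\<close>: each differentiation multiplies by \<open>l\<close> and
    advances the phase by \<open>pi / 2\<close>.\<close>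
  define G where "G = (\<lambda>k x. M / l * (l ^ k * sin (l * x + real k * (pi / 2))))"
  have "(G k has_real_derivative G (Suc k) x) (at x)" for k x
  proof -
    have "l * x + real (Suc k) * (pi / 2) = (l * x + real k * (pi / 2)) + pi / 2"
      by (simp add: algebra_simps)
    then have "sin (l * x + real (Suc k) * (pi / 2)) = cos (l * x + real k * (pi / 2))"
      by (simp only: sin_add cos_pi_half sin_pi_half mult_zero_right mult_1_right add_0)
    then show ?thesis
      unfolding G_def by (auto intro!: derivative_eq_intros)
  qed
  moreover have "G 0 0 = 0" "G (Suc 0) 0 = M"
    using l by (simp_all add: G_def)
  moreover have "\<bar>G 0 x\<bar> \<le> \<epsilon>" for x
  proof -
    have "\<bar>G 0 x\<bar> = \<bar>M\<bar> / l * \<bar>sin (l * x)\<bar>"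
      using l by (simp add: G_def abs_mult)
    also have "\<dots> \<le> \<bar>M\<bar> / l * 1"
      using l by (intro mult_left_mono abs_sin_le_one) auto
    also have "\<dots> \<le> \<epsilon>"
      using l by (simp add: field_simps)
    finally show ?thesis .
  qed
  ultimately show ?case by (intro exI[of _ G]) auto
next
  case (Suc n)
  then obtain G where G: "\<And>k x. (G k has_real_derivative G (Suc k) x) (at x)"
    "\<And>k. k \<le> n \<Longrightarrow> G k 0 = 0" "G (Suc n) 0 = M"
    "\<And>k x. k \<le> n \<Longrightarrow> \<bar>x\<bar> \<le> 1 \<Longrightarrow> \<bar>G k x\<bar> \<le> \<epsilon>" by blast
  have "\<exists>A. \<forall>x::real. -\<infinity> < ereal x \<longrightarrow> ereal x < \<infinity> \<longrightarrow> (A has_vector_derivative G 0 x) (at x)"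
    by (rule einterval_antiderivative) (use G(1)[of 0] DERIV_isCont in auto)
  then obtain A where A: "\<And>x. (A has_real_derivative G 0 x) (at x)"
    by (auto simp: has_real_derivative_iff_has_vector_derivative)
  \<comment> \<open>Prepending the primitive that vanishes at 0 shifts all orders up by one. Where
    \<open>\<bar>x\<bar> \<le> 1\<close>, this primitive of a function bounded by
    \<open>\<epsilon>\<close> is again bounded by \<open>\<epsilon>\<close>.\<close>
  define H where "H = case_nat (\<lambda>x. A x - A 0) G"
  have H: "(H k has_real_derivative H (Suc k) x) (at x)" for k x
    unfolding H_def using G(1) A
    by (cases k) (auto intro!: derivative_eq_intros)
  moreover have "\<forall>k\<le>Suc n. H k 0 = 0" "H (Suc (Suc n)) 0 = M"
    using G(2,3) by (auto simp: H_def split: nat.split)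
  moreover have "\<bar>H k x\<bar> \<le> \<epsilon>" if "k \<le> Suc n" "\<bar>x\<bar> \<le> 1" for k x
  proof (cases k)
    case 0
    have "norm (A x - A 0) \<le> \<epsilon> * norm (x - 0)"
    proof (rule field_differentiable_bound[of "cball 0 1" A "G 0" \<epsilon>])
      show "norm (G 0 z) \<le> \<epsilon>" if "z \<in> cball 0 1" for z
        using G(4)[of 0 z] that by simp
      show "(A has_real_derivative G 0 z) (at z within cball 0 1)" for z
        using A by (rule has_field_derivative_at_within)
    qed (use that in auto)
    also have "\<dots> \<le> \<epsilon>"
      using that assms by (simp add: mult_left_le)
    finally show ?thesis by (simp add: H_def 0)
  next
    case (Suc j)
    then show ?thesis using G(4) that by (simp add: H_def)
  qed
  ultimately show ?case by blast
qed

lemma ex_small_derivatives: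
  fixes M \<epsilon> :: real
  assumes "0 < \<epsilon>"
  shows "\<exists>G. (\<forall>k x. (G k has_real_derivative G (Suc k) x) (at x)) \<and> (\<forall>k<n. G k 0 = 0) \<and>
    G n 0 = M \<and> (\<forall>k<n. \<forall>x. \<bar>x\<bar> \<le> 1 \<longrightarrow> \<bar>G k x\<bar> \<le> \<epsilon>)"
proof (cases n)
  case 0
  have "((case_nat (\<lambda>x. M) (\<lambda>_ _. 0) k) has_real_derivative
      case_nat (\<lambda>x. M) (\<lambda>_ _. 0) (Suc k) x) (at x)" for k and x :: real
    by (cases k) auto
  then show ?thesis
    by (intro exI[of _ "case_nat (\<lambda>x. M) (\<lambda>_ _. 0)"]) (auto simp: 0)
next
  case (Suc m)
  then show ?thesis using ex_small_derivatives_Suc[OF assms, of m M] by (simp add: less_Suc_eq_le)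
qed

text \<open>In Borel's theorem a function comes with explicit candidates for all its derivatives;
  this identifies them with the iterates of \<open>deriv\<close>.\<close>

lemma funpow_deriv_eq:
  assumes "open U" "\<And>k x. x \<in> U \<Longrightarrow> (F k has_real_derivative F (Suc k) x) (at x)" "x \<in> U"
  shows "(deriv ^^ k) (F 0) x = F k x"
  using assms(3)
proof (induction k arbitrary: x)
  case (Suc k)
  have "((deriv ^^ k) (F 0) has_real_derivative F (Suc k) x) (at x)"
    by (rule has_field_derivative_transform_within_open[OF assms(2)[OF Suc.prems] assms(1) Suc.prems])
      (simp add: Suc.IH)
  then show ?case by (simp add: DERIV_imp_deriv)
qed simp

lemma smooth_on_of_derivative_sequence:
  fixes F :: "nat \<Rightarrow> real \<Rightarrow> real"
  assumes "open U" "\<And>k x. x \<in> U \<Longrightarrow> (F k has_real_derivative F (Suc k) x) (at x)"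
  shows "smooth_on U (F n)"
  unfolding smooth_on_def
proof
  show "C_diff_on k U (F n)" for k
  proof (induction k arbitrary: n)
    case 0
    show ?case
      using assms(2)[of _ n] DERIV_isCont by (auto intro!: continuous_at_imp_continuous_on)
  next
    case (Suc k)
    show ?case by (rule C_diff_on_SucI_real[OF assms Suc.IH])
  qed
qed

text \<open>The function is built by successive corrections. Correction \<open>n\<close> keeps the
  derivatives at 0 of orders below \<open>n\<close>, sets the one of order \<open>n\<close> right,
  and has derivatives of orders below \<open>n\<close> bounded by \<open>(1 / 2) ^ n\<close> where
  \<open>\<bar>x\<bar> \<le> 1\<close>. For each fixed order the derivatives thus converge
  uniformly, and the limit may be differentiated termwise.\<close>

lemma Borel_theorem:
  fixes a :: "nat \<Rightarrow> real"
  obtains f where "smooth_on (ball 0 1) f" "\<And>k. (deriv ^^ k) f 0 = a k"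
proof -
  \<comment> \<open>\<open>p k\<close> stands for the derivative of order \<open>k\<close> of the
    current approximation.\<close>
  let ?P = "\<lambda>n p. (\<forall>k x. (p k has_real_derivative p (Suc k) x) (at x)) \<and> (\<forall>k<n. p k 0 = a k)"
  let ?Q = "\<lambda>n p q. \<forall>k<n. \<forall>x. \<bar>x\<bar> \<le> (1::real) \<longrightarrow> \<bar>q k x - p k x\<bar> \<le> (1 / 2) ^ n"
  have "\<exists>P. \<forall>n. ?P n (P n) \<and> ?Q n (P n) (P (Suc n))"
  proof (rule dependent_nat_choice)
    show "\<exists>p. ?P 0 p"
      by (rule exI[of _ "\<lambda>_ _. 0"]) auto
    show "\<exists>q. ?P (Suc n) q \<and> ?Q n p q" if p: "?P n p" for p n
    proof -
      obtain G where G: "\<And>k x. (G k has_real_derivative G (Suc k) x) (at x)"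
        "\<And>k. k < n \<Longrightarrow> G k 0 = 0" "G n 0 = a n - p n 0"
        "\<And>k x. k < n \<Longrightarrow> \<bar>x\<bar> \<le> 1 \<Longrightarrow> \<bar>G k x\<bar> \<le> (1 / 2) ^ n"
        using ex_small_derivatives[of "(1 / 2) ^ n" n "a n - p n 0", simplified] by blast
      show ?thesis
      proof (rule exI[of _ "\<lambda>k x. p k x + G k x"], intro conjI allI impI)
        show "((\<lambda>x. p k x + G k x) has_real_derivative p (Suc k) x + G (Suc k) x) (at x)" for k x
          using p G(1) by (intro DERIV_add) auto
        show "p k 0 + G k 0 = a k" if "k < Suc n" for k
          using p G(2,3) that by (auto simp: less_Suc_eq)
        show "\<bar>p k x + G k x - p k x\<bar> \<le> (1 / 2) ^ n" if "k < n" "\<bar>x\<bar> \<le> 1" for k x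
          using G(4) that by simp
      qed
    qed
  qed
  then obtain P where PQ: "\<forall>n. ?P n (P n) \<and> ?Q n (P n) (P (Suc n))" by (rule exE)
  have P: "(P n k has_real_derivative P n (Suc k) x) (at x)" for n k x
    using PQ[THEN spec, of n] by simp
  have P0: "P n k 0 = a k" if "k < n" for n k
    using PQ[THEN spec, of n] that by simp
  have PSuc: "\<bar>P (Suc n) k x - P n k x\<bar> \<le> (1 / 2) ^ n" if "k < n" "\<bar>x\<bar> \<le> 1" for n k x
    using PQ[THEN spec, of n] that by simp
  \<comment> \<open>A partial sum of the geometric series, kept in exact form so that the induction
    on \<open>i\<close> closes.\<close>
  have bound: "\<bar>P (n + i) k x - P n k x\<bar> \<le> 2 * (1 / 2) ^ n - 2 * (1 / 2) ^ (n + i)"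
    if "k < n" "\<bar>x\<bar> \<le> 1" for n i k x
  proof (induction i)
    case (Suc i)
    have "\<bar>P (n + Suc i) k x - P (n + i) k x\<bar> \<le> (1 / 2) ^ (n + i)"
      using PSuc[of k "n + i" x] that by simp
    moreover have "(1 / 2 :: real) ^ (n + Suc i) = (1 / 2) ^ (n + i) / 2" by simp
    ultimately show ?case using Suc by linarith
  qed simp
  have bound': "\<bar>P m k x - P n k x\<bar> \<le> 2 * (1 / 2) ^ n" if "k < n" "n \<le> m" "\<bar>x\<bar> \<le> 1" for n m k x
  proof -
    from that(2) obtain i where "m = n + i" by (rule le_Suc_ex[THEN exE])
    have "0 \<le> (1 / 2 :: real) ^ (n + i)" by simp
    moreover note bound[OF that(1,3), of i]
    ultimately have "\<bar>P (n + i) k x - P n k x\<bar> \<le> 2 * (1 / 2) ^ n" by linarith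
    then show ?thesis unfolding \<open>m = n + i\<close> .
  qed
  define F where "F = (\<lambda>k x. lim (\<lambda>n. P n k x))"
  have lim: "(\<lambda>n. P n k x) \<longlonglongrightarrow> F k x" if "\<bar>x\<bar> \<le> 1" for k x
  proof -
    have "Cauchy (\<lambda>n. P n k x)"
    proof (rule metric_CauchyI)
      fix e :: real
      assume "e > 0"
      then obtain N where N: "(1 / 2) ^ N < e / 4"
        using real_arch_pow_inv[of "e / 4" "1 / 2"] by auto
      \<comment> \<open>From index \<open>Suc k\<close> on, the estimates cover the derivative of
        order \<open>k\<close>.\<close>
      define N' where "N' = max N (Suc k)"
      have N': "(1 / 2 :: real) ^ N' \<le> (1 / 2) ^ N"
        unfolding N'_def by (intro power_decreasing) auto
      have "dist (P m k x) (P n k x) < e" if "m \<ge> N'" "n \<ge> N'" for m n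
      proof -
        have "k < N'" by (simp add: N'_def)
        from bound'[OF this that(1) \<open>\<bar>x\<bar> \<le> 1\<close>] bound'[OF this that(2) \<open>\<bar>x\<bar> \<le> 1\<close>] N N'
        show ?thesis unfolding dist_real_def by linarith
      qed
      then show "\<exists>N. \<forall>m\<ge>N. \<forall>n\<ge>N. dist (P m k x) (P n k x) < e" by blast
    qed
    then show ?thesis
      unfolding F_def by (simp add: Cauchy_convergent_iff convergent_LIMSEQ_iff)
  qed
  have F0: "F k 0 = a k" for k
  proof (rule LIMSEQ_unique[OF lim])
    show "(\<lambda>n. P n k 0) \<longlonglongrightarrow> a k"
      by (rule tendsto_eventually) (auto simp: eventually_sequentially intro!: exI[of _ "Suc k"] P0)
  qed simp
  have boundF: "\<bar>P n k x - F k x\<bar> \<le> 2 * (1 / 2) ^ n" if "k < n" "\<bar>x\<bar> \<le> 1" for n k x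
  proof (rule LIMSEQ_le_const2)
    show "(\<lambda>m. \<bar>P n k x - P m k x\<bar>) \<longlonglongrightarrow> \<bar>P n k x - F k x\<bar>"
      by (intro tendsto_intros lim that)
    show "\<exists>N. \<forall>m\<ge>N. \<bar>P n k x - P m k x\<bar> \<le> 2 * (1 / 2) ^ n"
      using bound'[OF that(1) _ that(2)] by (auto simp: abs_minus_commute)
  qed
  have F: "(F k has_real_derivative F (Suc k) x) (at x)" if x: "x \<in> ball 0 1" for k x
  proof -
    \<comment> \<open>Termwise differentiation: the values converge at 0 and the derivatives
      converge uniformly on the ball.\<close>
    have "\<exists>g. \<forall>x\<in>ball 0 1. (\<lambda>n. P n k x) \<longlonglongrightarrow> g x \<and>
        (g has_derivative (*) (F (Suc k) x)) (at x within ball 0 1)"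
    proof (rule has_derivative_sequence[where ?x0.0 = 0 and f' = "\<lambda>n x. (*) (P n (Suc k) x)"])
      show "(\<lambda>n. P n k 0) \<longlonglongrightarrow> F k 0" by (rule lim) simp
      show "(P n k has_derivative (*) (P n (Suc k) x)) (at x within ball 0 1)" for n x
        using has_field_derivative_at_within[OF P] by (simp add: has_field_derivative_def)
      fix e :: real
      assume "e > 0"
      then obtain N where N: "(1 / 2) ^ N < e / 2"
        using real_arch_pow_inv[of "e / 2" "1 / 2"] by auto
      have "\<bar>P n (Suc k) x - F (Suc k) x\<bar> \<le> e" if "n \<ge> max N (Suc (Suc k))" "\<bar>x\<bar> \<le> 1" for n x
      proof -
        have "(1 / 2 :: real) ^ n \<le> (1 / 2) ^ N"
          using that by (intro power_decreasing) auto
        moreover have "Suc k < n" using that(1) by simp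
        note boundF[OF this that(2)]
        ultimately show ?thesis using N by linarith
      qed
      then show "\<forall>\<^sub>F n in sequentially. \<forall>x\<in>ball 0 1. \<forall>h.
          norm (P n (Suc k) x * h - F (Suc k) x * h) \<le> e * norm h"
        unfolding eventually_sequentially
        by (intro exI[of _ "max N (Suc (Suc k))"])
          (auto simp: abs_mult mult_right_mono simp flip: left_diff_distrib)
    qed auto
    then obtain g where g: "\<And>x. x \<in> ball 0 1 \<Longrightarrow> (\<lambda>n. P n k x) \<longlonglongrightarrow> g x"
      "\<And>x. x \<in> ball 0 1 \<Longrightarrow> (g has_derivative (*) (F (Suc k) x)) (at x within ball 0 1)"
      by blast
    have "(g has_real_derivative F (Suc k) x) (at x)"
      using g(2)[OF x] by (simp add: has_field_derivative_def at_within_open[OF x open_ball])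
    moreover have "g y = F k y" if "y \<in> ball 0 1" for y
      using LIMSEQ_unique[OF g(1)[OF that] lim] that by simp
    ultimately show ?thesis
      using has_field_derivative_transform_within_open[OF _ open_ball x] by blast
  qed
  show thesis
  proof
    show "smooth_on (ball 0 1) (F 0)"
      using F by (rule smooth_on_of_derivative_sequence[OF open_ball, where F = F])
    show "(deriv ^^ k) (F 0) 0 = a k" for k
      using funpow_deriv_eq[of "ball 0 1" F 0 k] F F0 by simp
  qed
qed

section \<open>Division by the cube\<close>

text \<open>Vanishing to infinite order at 0, phrased by smooth quotients rather than by
  derivatives, since powers of \<open>x\<close> are what the cube root consumes.\<close>

definition flat_on :: "real \<Rightarrow> (real \<Rightarrow> real) \<Rightarrow> bool" where
  "flat_on e F \<longleftrightarrow> (\<forall>n. \<exists>g. smooth_on (ball 0 e) g \<and> (\<forall>x\<in>ball 0 e. F x = x ^ n * g x))"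

lemma flat_on_smooth_on: "flat_on e F \<Longrightarrow> smooth_on (ball 0 e) F"
proof -
  assume "flat_on e F"
  then obtain g where "smooth_on (ball 0 e) g" "\<And>x. x \<in> ball 0 e \<Longrightarrow> F x = x ^ 0 * g x"
    unfolding flat_on_def by blast
  then show ?thesis using smooth_on_cong[OF open_ball, of 0 e F g] by simp
qed

text \<open>This operation on \<open>F\<close> corresponds to differentiating
  \<open>F (root 3 x)\<close>. Differentiation and division together cost three powers of
  \<open>x\<close>, and a flat function has powers to spare.\<close>

lemma flat_on_deriv_divide:
  assumes "flat_on e F"
  shows "flat_on e (\<lambda>x. deriv F x / (3 * x\<^sup>2))"
  unfolding flat_on_def
proof
  fix n
  obtain g where g: "smooth_on (ball 0 e) g" "\<And>x. x \<in> ball 0 e \<Longrightarrow> F x = x ^ (n + 4) * g x"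
    using assms unfolding flat_on_def by blast
  \<comment> \<open>The extra factor \<open>x\<close>, gained by starting from \<open>n + 4\<close>
    instead of \<open>n + 3\<close>, makes both sides 0 at \<open>x = 0\<close> even for
    \<open>n = 0\<close>; the left side is a division by 0 there.\<close>
  let ?h = "\<lambda>x. x * (real (n + 4) * g x + x * deriv g x) / 3"
  have "deriv F x / (3 * x\<^sup>2) = x ^ n * ?h x" if x: "x \<in> ball 0 e" for x
  proof -
    have "((\<lambda>x. x ^ (n + 4) * g x) has_real_derivative
        x ^ (n + 3) * (real (n + 4) * g x + x * deriv g x)) (at x)"
      by (rule DERIV_cong[OF DERIV_mult[OF DERIV_pow
            smooth_on_has_real_derivative[OF open_ball g(1) x]]])
        (simp add: algebra_simps eval_nat_numeral)
    then have "(F has_real_derivative x ^ (n + 3) * (real (n + 4) * g x + x * deriv g x)) (at x)"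
      by (rule has_field_derivative_transform_within_open[OF _ open_ball x]) (simp add: g(2))
    then show ?thesis
      by (simp add: DERIV_imp_deriv power_add power2_eq_square power3_eq_cube)
  qed
  moreover have "smooth_on (ball 0 e) ?h"
    by (intro smooth_on_intros g(1) open_ball) auto
  ultimately show "\<exists>g. smooth_on (ball 0 e) g \<and>
      (\<forall>x\<in>ball 0 e. deriv F x / (3 * x\<^sup>2) = x ^ n * g x)" by blast
qed

lemma root_3_in_ball: "0 < e \<Longrightarrow> x \<in> ball 0 (e ^ 3) \<Longrightarrow> root 3 x \<in> ball 0 e"
  using real_root_less_mono[of 3 "\<bar>x\<bar>" "e ^ 3"] by (simp add: real_root_abs real_root_power_cancel)

text \<open>The cube root fails to be differentiable only at 0, where flatness compensates. The
  derivative has the same form, with \<open>F\<close> replaced by the flat function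
  \<open>\<lambda>x. deriv F x / (3 * x\<^sup>2)\<close>, so induction on the class applies.\<close>

lemma smooth_on_flat_root:
  assumes "0 < e" "flat_on e F"
  shows "smooth_on (ball 0 (e ^ 3)) (\<lambda>x. F (root 3 x))"
  unfolding smooth_on_def
proof
  show "C_diff_on k (ball 0 (e ^ 3)) (\<lambda>x. F (root 3 x))" for k
    using assms(2)
  proof (induction k arbitrary: F)
    case 0
    have "continuous_on (ball 0 e) F"
      by (rule smooth_on_continuous_on[OF flat_on_smooth_on[OF 0]])
    then show ?case
      using root_3_in_ball[OF assms(1)]
      by (auto intro!: continuous_on_compose2[of "ball 0 e" F] continuous_intros)
  next
    case (Suc k)
    let ?r = "root 3 :: real \<Rightarrow> real"
    have "((\<lambda>x. F (?r x)) has_real_derivative deriv F (?r x) / (3 * (?r x)\<^sup>2)) (at x)"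
      if x: "x \<in> ball 0 (e ^ 3)" for x
    proof (cases "x = 0")
      case False
      have "(?r has_real_derivative inverse (3 * (?r x)\<^sup>2)) (at x)"
        using DERIV_odd_real_root[of 3 x] False by simp
      from DERIV_chain2[OF smooth_on_has_real_derivative[OF open_ball
            flat_on_smooth_on[OF Suc.prems] root_3_in_ball[OF assms(1) x]] this]
      show ?thesis by (simp only: divide_inverse)
    next
      case True
      \<comment> \<open>With \<open>x ^ 6\<close> split off, \<open>F (?r x)\<close> is
        \<open>x\<^sup>2\<close> times a continuous function, so its derivative at 0 is 0. The
        claimed formula has this value too, by the convention for division by 0.\<close>
      obtain g where g: "smooth_on (ball 0 e) g" "\<And>x. x \<in> ball 0 e \<Longrightarrow> F x = x ^ 6 * g x"
        using Suc.prems unfolding flat_on_def by blast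
      have "continuous_on (ball 0 (e ^ 3)) (\<lambda>x. x * g (?r x))"
        using root_3_in_ball[OF assms(1)] smooth_on_continuous_on[OF g(1)]
        by (auto intro!: continuous_intros continuous_on_compose2[of "ball 0 e" g])
      then have "isCont (\<lambda>x. x * g (?r x)) 0"
        by (rule continuous_on_interior) (use assms(1) in auto)
      then have "((\<lambda>x. x * (x * g (?r x))) has_real_derivative 0) (at 0)"
        unfolding CARAT_DERIV by (intro exI[of _ "\<lambda>x. x * g (?r x)"]) simp
      moreover have "y * (y * g (?r y)) = F (?r y)" if "y \<in> ball 0 (e ^ 3)" for y
      proof -
        have "?r y ^ 6 = (?r y ^ 3) ^ 2" by (simp flip: power_mult)
        also have "\<dots> = y * y" by (simp add: odd_real_root_pow power2_eq_square)
        finally show ?thesis using g(2)[OF root_3_in_ball[OF assms(1) that]] by simp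
      qed
      ultimately have "((\<lambda>x. F (?r x)) has_real_derivative 0) (at 0)"
        using has_field_derivative_transform_within_open[OF _ open_ball, of "\<lambda>x. x * (x * g (?r x))" 0 0 0 "e ^ 3"]
          assms(1) by simp
      then show ?thesis by (simp add: True)
    qed
    then show ?case
      by (rule C_diff_on_SucI_real[OF open_ball _ Suc.IH[OF flat_on_deriv_divide[OF Suc.prems]]])
  qed
qed

lemma sum_lessThan_mult_3:
  fixes f :: "nat \<Rightarrow> 'a::comm_monoid_add"
  shows "(\<Sum>k<3 * n. f k) = (\<Sum>k<n. f (3 * k) + f (3 * k + 1) + f (3 * k + 2))"
proof (induction n)
  case (Suc n)
  have "3 * Suc n = Suc (Suc (Suc (3 * n)))" by simp
  then show ?case by (simp only: sum.lessThan_Suc Suc.IH) (simp add: add.assoc)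
qed simp

text \<open>Borel's theorem solves the problem up to a flat function, which stays smooth after
  composition with the cube root.\<close>

lemma cubic_division:
  fixes R :: "real \<Rightarrow> real"
  assumes "0 < e" "e \<le> 1" "smooth_on (ball 0 e) R"
  obtains r0 r1 r2 where
    "smooth_on (ball 0 (e ^ 3)) r0" "smooth_on (ball 0 (e ^ 3)) r1" "smooth_on (ball 0 (e ^ 3)) r2"
    "\<And>t. t \<in> ball 0 e \<Longrightarrow> R t = r0 (t ^ 3) + t * r1 (t ^ 3) + t\<^sup>2 * r2 (t ^ 3)"
proof -
  define a where "a = (\<lambda>k. (deriv ^^ k) R 0 / fact k)"
  \<comment> \<open>\<open>g i\<close> collects the Taylor coefficients of \<open>R\<close> with
    index \<open>i\<close> modulo 3. Borel's theorem prescribes derivatives, whence the factor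
    \<open>fact k\<close>.\<close>
  have "\<exists>g. smooth_on (ball 0 1) g \<and> (\<forall>k. (deriv ^^ k) g 0 = fact k * a (3 * k + i))" for i
    using Borel_theorem[of "\<lambda>k. fact k * a (3 * k + i)"] by blast
  then obtain g where g: "\<And>i. smooth_on (ball 0 1) (g i)"
    "\<And>i k. (deriv ^^ k) (g i) 0 = fact k * a (3 * k + i)" by metis
  have cube: "t ^ 3 \<in> ball 0 (e ^ 3)" if "t \<in> ball 0 e" for t :: real
    using that power_strict_mono[of "\<bar>t\<bar>" e 3] by (simp add: power_abs)
  have sub: "ball 0 (e ^ 3) \<subseteq> ball (0::real) 1"
    using assms(1,2) by (intro subset_ball) (simp add: power_le_one)
  have cube1: "t ^ 3 \<in> ball 0 1" if "t \<in> ball 0 e" for t :: real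
    using cube[OF that] sub by blast
  have g': "smooth_on (ball 0 (e ^ 3)) (g i)" for i
    by (rule smooth_on_subset[OF g(1) sub])
  have comp: "smooth_on (ball 0 e) (\<lambda>t. h (t ^ 3))" if "smooth_on (ball 0 1) h" for h :: "real \<Rightarrow> real"
    by (rule smooth_on_compose[OF that open_ball open_ball _ cube1])
      (intro smooth_on_intros open_ball)
  define F where "F = (\<lambda>t. R t - g 0 (t ^ 3) - t * g 1 (t ^ 3) - t\<^sup>2 * g 2 (t ^ 3))"
  have "flat_on e F"
    unfolding flat_on_def
  proof
    fix n
    \<comment> \<open>Expanding \<open>R\<close> to length \<open>3 * n\<close> and each
      \<open>g i\<close> to length \<open>n\<close> makes the polynomial parts cancel exactly; all
      remainders contain \<open>t ^ (3 * n)\<close>.\<close>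
    obtain \<rho> where \<rho>: "smooth_on (ball 0 e) \<rho>"
      "\<And>x. x \<in> ball 0 e \<Longrightarrow> R x = (\<Sum>k<3 * n. a k * x ^ k) + x ^ (3 * n) * \<rho> x"
      using smooth_on_Taylor[OF assms(1,3), of "3 * n"] unfolding a_def by blast
    have "\<exists>h. smooth_on (ball 0 1) h \<and>
        (\<forall>x\<in>ball 0 1. g i x = (\<Sum>k<n. a (3 * k + i) * x ^ k) + x ^ n * h x)" for i
      using smooth_on_Taylor[OF _ g(1)[of i], of n] by (auto simp: g(2))
    then obtain h where h: "\<And>i. smooth_on (ball 0 1) (h i)"
      "\<And>i x. x \<in> ball 0 1 \<Longrightarrow> g i x = (\<Sum>k<n. a (3 * k + i) * x ^ k) + x ^ n * h i x"
      by metis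
    let ?\<sigma> = "\<lambda>t. t ^ (2 * n) * (\<rho> t - h 0 (t ^ 3) - t * h 1 (t ^ 3) - t\<^sup>2 * h 2 (t ^ 3))"
    have "F t = t ^ n * ?\<sigma> t" if t: "t \<in> ball 0 e" for t
    proof -
      have "(\<Sum>k<3 * n. a k * t ^ k) = (\<Sum>k<n. a (3 * k) * (t ^ 3) ^ k) +
          t * (\<Sum>k<n. a (3 * k + 1) * (t ^ 3) ^ k) + t\<^sup>2 * (\<Sum>k<n. a (3 * k + 2) * (t ^ 3) ^ k)"
        unfolding sum_lessThan_mult_3 sum_distrib_left sum.distrib[symmetric]
        by (intro sum.cong refl) (simp add: power_add power2_eq_square algebra_simps flip: power_mult)
      moreover have "(t ^ 3) ^ n = t ^ n * t ^ (2 * n)" "t ^ (3 * n) = t ^ n * t ^ (2 * n)"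
        by (simp_all flip: power_mult power_add)
      ultimately show ?thesis
        unfolding F_def \<rho>(2)[OF t] h(2)[OF cube1[OF t]] by (simp add: algebra_simps)
    qed
    moreover have "smooth_on (ball 0 e) ?\<sigma>"
      by (intro smooth_on_intros comp h(1) \<rho>(1) open_ball)
    ultimately show "\<exists>g. smooth_on (ball 0 e) g \<and> (\<forall>x\<in>ball 0 e. F x = x ^ n * g x)" by blast
  qed
  \<comment> \<open>The flat discrepancy is absorbed into the first coefficient, as the cube root
    turns \<open>t ^ 3\<close> back into \<open>t\<close>.\<close>
  from smooth_on_flat_root[OF assms(1) this]
  have "smooth_on (ball 0 (e ^ 3)) (\<lambda>x. g 0 x + F (root 3 x))"
    by (intro smooth_on_add open_ball g')
  moreover have "R t = (g 0 (t ^ 3) + F (root 3 (t ^ 3))) + t * g 1 (t ^ 3) + t\<^sup>2 * g 2 (t ^ 3)" for t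
    by (simp add: F_def odd_real_root_power_cancel)
  ultimately show thesis using that g' by blast
qed

section \<open>Local diffeomorphisms\<close>

text \<open>The inverse function theorem in one variable. A nonvanishing derivative gives
  injectivity by the mean value theorem; smoothness of the inverse is bootstrapped from the formula
  for its derivative, which contains \<open>\<phi>\<close> itself.\<close>

lemma smooth_local_inverse:
  fixes \<tau> :: "real \<Rightarrow> real"
  assumes "0 < e" "smooth_on (ball 0 e) \<tau>" "deriv \<tau> 0 \<noteq> 0"
  obtains d V \<phi> where "0 < d" "d \<le> e" "open V" "homeomorphism (ball 0 d) V \<tau> \<phi>" "smooth_on V \<phi>"
proof -
  have "continuous_on (ball 0 e) (deriv \<tau>)"
    by (intro smooth_on_continuous_on smooth_on_deriv open_ball assms)
  then have "open (ball 0 e \<inter> deriv \<tau> -` (- {0}))"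
    by (intro continuous_open_preimage) (auto simp: open_Compl)
  then obtain d where d: "0 < d" "ball 0 d \<subseteq> ball 0 e \<inter> deriv \<tau> -` (- {0})"
    using assms(1,3) openE[of _ 0] by (metis (no_types, lifting) Compl_iff IntI centre_in_ball singletonD vimageI)
  have "d \<le> e" using d by (simp add: ball_subset_ball_iff)
  have \<tau>: "smooth_on (ball 0 d) \<tau>" using smooth_on_subset[OF assms(2)] d by blast
  note D = smooth_on_has_real_derivative[OF open_ball \<tau>]
  have nz: "deriv \<tau> x \<noteq> 0" if "x \<in> ball 0 d" for x using d that by blast
  have "inj_on \<tau> (ball 0 d)"
  proof (rule linorder_inj_onI')
    fix x y :: real
    assume xy: "x \<in> ball 0 d" "y \<in> ball 0 d" "x < y"
    then have sub: "z \<in> ball 0 d" if "x \<le> z" "z \<le> y" for z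
      using that by (auto simp: dist_real_def)
    obtain z where "x < z" "z < y" "\<tau> y - \<tau> x = (y - x) * deriv \<tau> z"
      using MVT2[OF xy(3), of \<tau> "deriv \<tau>"] D sub by blast
    then show "\<tau> x \<noteq> \<tau> y" using nz[of z] sub[of z] xy(3) by auto
  qed
  then obtain \<phi> where \<phi>: "homeomorphism (ball 0 d) (\<tau> ` ball 0 d) \<tau> \<phi>"
    using invariance_of_domain_homeomorphism[OF open_ball smooth_on_continuous_on[OF \<tau>]] by auto
  have V: "open (\<tau> ` ball 0 d)"
    by (rule invariance_of_domain[OF smooth_on_continuous_on[OF \<tau>] open_ball]) fact
  have inv: "\<phi> y \<in> ball 0 d" "\<tau> (\<phi> y) = y" if "y \<in> \<tau> ` ball 0 d" for y
    using \<phi> that unfolding homeomorphism_def by blast+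
  have D\<phi>: "(\<phi> has_real_derivative inverse (deriv \<tau> (\<phi> y))) (at y)" if y: "y \<in> \<tau> ` ball 0 d" for y
  proof -
    obtain \<epsilon> where \<epsilon>: "\<epsilon> > 0" "ball y \<epsilon> \<subseteq> \<tau> ` ball 0 d" using openE[OF V y] by blast
    show ?thesis
    proof (rule DERIV_inverse_function[where f = \<tau> and g = \<phi> and x = y,
          OF D[OF inv(1)[OF y]] nz[OF inv(1)[OF y]]])
      show "y - \<epsilon> < y" "y < y + \<epsilon>" using \<epsilon>(1) by auto
      show "\<tau> (\<phi> z) = z" if "y - \<epsilon> < z" "z < y + \<epsilon>" for z
        using \<epsilon>(2) inv(2)[of z] that by (auto simp: subset_iff dist_real_def)
      show "isCont \<phi> y"
        using \<phi> y V unfolding homeomorphism_def by (meson continuous_on_eq_continuous_at)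
    qed
  qed
  have h: "smooth_on (ball 0 d) (\<lambda>x. inverse (deriv \<tau> x))"
    by (intro smooth_on_inverse smooth_on_deriv open_ball \<tau> nz)
  have "C_diff_on k (\<tau> ` ball 0 d) \<phi>" for k
  proof (induction k)
    case 0
    show ?case using \<phi> by (simp add: homeomorphism_def)
  next
    case (Suc k)
    show ?case
    proof (rule C_diff_on_SucI_real[OF V D\<phi>])
      show "C_diff_on k (\<tau> ` ball 0 d) (\<lambda>y. inverse (deriv \<tau> (\<phi> y)))"
        using inv(1) by (intro C_diff_on_compose[OF V open_ball _ Suc.IH smooth_onD[OF h]]) auto
    qed
  qed
  then have "smooth_on (\<tau> ` ball 0 d) \<phi>" by (simp add: smooth_on_def)
  with that[OF d(1) \<open>d \<le> e\<close> V \<phi>] show thesis .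
qed

text \<open>\<open>a'\<close> and \<open>b'\<close> represent the coordinate functionals of the
  basis \<open>a\<close>, \<open>b\<close>. In particular \<open>dual_bases k1 k2 k1 k2\<close>
  expresses that \<open>k1\<close>, \<open>k2\<close> is an orthonormal basis.\<close>

definition dual_bases :: "real^2 \<Rightarrow> real^2 \<Rightarrow> real^2 \<Rightarrow> real^2 \<Rightarrow> bool" where
  "dual_bases a b a' b' \<longleftrightarrow> a \<bullet> a' = 1 \<and> a \<bullet> b' = 0 \<and> b \<bullet> a' = 0 \<and> b \<bullet> b' = 1 \<and>
    (\<forall>v. (v \<bullet> a') *\<^sub>R a + (v \<bullet> b') *\<^sub>R b = v)"

lemma ex_dual_bases:
  assumes "det2 a b \<noteq> 0"
  obtains a' b' where "dual_bases a b a' b'"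
proof -
  \<comment> \<open>Cramer's rule: \<open>i\<close> is the reciprocal of the determinant.\<close>
  define i where "i = inverse (a $ 1 * b $ 2 - a $ 2 * b $ 1)"
  have i: "i * (a $ 1 * b $ 2 - a $ 2 * b $ 1) = 1"
    using assms by (simp add: i_def det2_def det_2)
  have "dual_bases a b (vector [i * b $ 2, - i * b $ 1]) (vector [- i * a $ 2, i * a $ 1])"
    unfolding dual_bases_def inner_vec_def sum_2 vec_eq_iff forall_2
  proof (intro conjI allI; simp)
  qed (use i in algebra)+
  then show thesis by (rule that)
qed

text \<open>The germ \<open>\<Psi>\<close> solves a quadratic equation for \<open>w\<close>, in the form of the quadratic formula that
  remains valid where the leading coefficient \<open>r\<close> vanishes.\<close>

lemma quadratic_diffeo_germ:
  fixes a b :: "real^2"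
  assumes "0 < d" and dual: "dual_bases a b a' b'" "dual_bases k1 k2 k1 k2"
    and sm: "smooth_on (ball 0 d) P" "smooth_on (ball 0 d) C" "smooth_on (ball 0 d) r"
    and P: "\<And>z. z \<in> ball 0 d \<Longrightarrow> P z > 0" and C: "C 0 = 0"
  obtains \<Psi> where "diffeo_germ p \<Psi>" "\<Psi> p = 0"
    "\<And>z w. z \<in> ball 0 d \<Longrightarrow> P z + 2 * r z * w > 0 \<Longrightarrow>
      \<Psi> (p + z *\<^sub>R a + (w * P z + C z + w\<^sup>2 * r z) *\<^sub>R b) = z *\<^sub>R k1 + w *\<^sub>R k2"
proof -
  \<comment> \<open>\<open>D z y\<close> is the discriminant of the equation
    \<open>Q z w = y\<close> in \<open>w\<close>, and \<open>S z y\<close> its root with the radical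
    moved to the denominator. The radical is written as a \<open>powr\<close> so that
    \<open>smooth_on_powr\<close> applies.\<close>
  define Q where "Q = (\<lambda>z w. w * P z + C z + w\<^sup>2 * r z)"
  define D where "D = (\<lambda>z y. (P z)\<^sup>2 + 4 * r z * (y - C z))"
  define S where "S = (\<lambda>z y. 2 * (y - C z) / (P z + D z y powr (1 / 2)))"
  \<comment> \<open>On the image of the quadratic the discriminant is the square of the derivative
    in \<open>w\<close>; where that derivative is positive, \<open>S\<close> returns
    \<open>w\<close>.\<close>
  have D_Q: "D z (Q z w) = (P z + 2 * r z * w)\<^sup>2" for z w
    by (simp add: D_def Q_def power2_eq_square algebra_simps)
  have S_Q: "S z (Q z w) = w" if "z \<in> ball 0 d" "P z + 2 * r z * w > 0" for z w
  proof -
    have "D z (Q z w) powr (1 / 2) = P z + 2 * r z * w"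
      using that(2) by (simp add: D_Q powr_half_sqrt)
    then have "S z (Q z w) = 2 * (Q z w - C z) / (2 * P z + 2 * r z * w)"
      by (simp add: S_def)
    also have "2 * (Q z w - C z) = w * (2 * P z + 2 * r z * w)"
      by (simp add: Q_def power2_eq_square algebra_simps)
    finally show ?thesis using P[OF that(1)] that(2) by simp
  qed
  \<comment> \<open>Conversely, where the discriminant is positive, its root \<open>s\<close> equals
    the derivative of the quadratic at \<open>S z y\<close>, which is therefore positive.\<close>
  have Q_S: "P z + 2 * r z * S z y > 0 \<and> Q z (S z y) = y" if z: "z \<in> ball 0 d" and "D z y > 0" for z y
  proof -
    define s where "s = D z y powr (1 / 2)"
    have s: "s > 0" "s\<^sup>2 = D z y" using that(2) by (simp_all add: s_def powr_half_sqrt)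
    have nz: "P z + s > 0" using P[OF z] s by simp
    have w: "S z y * (P z + s) = 2 * (y - C z)"
      using nz by (simp add: S_def s_def)
    have "(P z + 2 * r z * S z y) * (P z + s) = P z * (P z + s) + 2 * r z * (S z y * (P z + s))"
      by (simp add: algebra_simps)
    also have "\<dots> = s * (P z + s)"
      unfolding w using s(2) by (simp add: D_def power2_eq_square algebra_simps)
    finally have eq: "P z + 2 * r z * S z y = s" using nz by simp
    have "2 * (Q z (S z y) - C z) = S z y * (P z + (P z + 2 * r z * S z y))"
      by (simp add: Q_def power2_eq_square algebra_simps)
    also have "\<dots> = 2 * (y - C z)" unfolding eq w ..
    finally show ?thesis using eq s by simp
  qed
  \<comment> \<open>\<open>\<Psi>\<close> takes the coordinates of \<open>q - p\<close> in the basis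
    \<open>a\<close>, \<open>b\<close> and solves for \<open>w\<close>; \<open>G\<close> inserts
    \<open>w\<close> again. Their domains \<open>U\<close> and \<open>V\<close> are cut out by
    positivity of the discriminant and of the derivative in \<open>w\<close>.\<close>
  define \<Psi> where "\<Psi> = (\<lambda>q. ((q - p) \<bullet> a') *\<^sub>R k1 + S ((q - p) \<bullet> a') ((q - p) \<bullet> b') *\<^sub>R k2)"
  define G where "G = (\<lambda>v. p + (v \<bullet> k1) *\<^sub>R a + Q (v \<bullet> k1) (v \<bullet> k2) *\<^sub>R b)"
  define U0 where "U0 = {q. (q - p) \<bullet> a' \<in> ball 0 d}"
  define V0 where "V0 = {v::real^2. v \<bullet> k1 \<in> ball 0 d}"
  define U where "U = U0 \<inter> (\<lambda>q. D ((q - p) \<bullet> a') ((q - p) \<bullet> b')) -` {0<..}"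
  define V where "V = V0 \<inter> (\<lambda>v. P (v \<bullet> k1) + 2 * r (v \<bullet> k1) * (v \<bullet> k2)) -` {0<..}"
  have "open ((\<lambda>q. (q - p) \<bullet> a') -` ball 0 d)" "open ((\<lambda>v. v \<bullet> k1) -` ball 0 d)"
    by (intro continuous_open_vimage open_ball continuous_intros)+
  then have oU0: "open U0" and oV0: "open V0"
    by (simp_all add: U0_def V0_def vimage_def)
  have sU: "smooth_on U0 (\<lambda>q. h ((q - p) \<bullet> a'))" and sV: "smooth_on V0 (\<lambda>v. h (v \<bullet> k1))"
    if "smooth_on (ball 0 d) h" for h :: "real \<Rightarrow> real"
  proof -
    have "smooth_on U0 (\<lambda>q. (q - p) \<bullet> a')" "smooth_on V0 (\<lambda>v. v \<bullet> k1)"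
      by (intro smooth_on_intros oU0 oV0)+
    from smooth_on_compose[OF that open_ball oU0 this(1)] smooth_on_compose[OF that open_ball oV0 this(2)]
    show "smooth_on U0 (\<lambda>q. h ((q - p) \<bullet> a'))" "smooth_on V0 (\<lambda>v. h (v \<bullet> k1))"
      by (simp_all add: U0_def V0_def)
  qed
  have DU: "smooth_on U0 (\<lambda>q. D ((q - p) \<bullet> a') ((q - p) \<bullet> b'))"
    unfolding D_def by (intro smooth_on_intros sU sm oU0)
  have PV: "smooth_on V0 (\<lambda>v. P (v \<bullet> k1) + 2 * r (v \<bullet> k1) * (v \<bullet> k2))"
    by (intro smooth_on_intros sV sm oV0)
  have oU: "open U" and oV: "open V"
    unfolding U_def V_def
    by (intro continuous_open_preimage smooth_on_continuous_on DU PV oU0 oV0 open_greaterThan)+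
  have "smooth_on U \<Psi>"
    unfolding \<Psi>_def S_def
  proof (intro smooth_on_intros oU smooth_on_subset[OF DU] smooth_on_subset[OF sU] sm)
    show "P ((q - p) \<bullet> a') + D ((q - p) \<bullet> a') ((q - p) \<bullet> b') powr (1 / 2) \<noteq> 0" if "q \<in> U" for q
      using that P[of "(q - p) \<bullet> a'"] by (auto simp: U_def U0_def intro!: add_pos_nonneg less_imp_neq[symmetric])
  qed (auto simp: U_def)
  moreover have "smooth_on V G"
    unfolding G_def Q_def by (intro smooth_on_intros oV smooth_on_subset[OF sV] sm) (auto simp: V_def)
  moreover have GV: "(G v - p) \<bullet> a' = v \<bullet> k1" "(G v - p) \<bullet> b' = Q (v \<bullet> k1) (v \<bullet> k2)" for v
    using dual(1) by (simp_all add: G_def dual_bases_def inner_add_left algebra_simps)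
  moreover have \<Psi>U: "\<Psi> q \<bullet> k1 = (q - p) \<bullet> a'" "\<Psi> q \<bullet> k2 = S ((q - p) \<bullet> a') ((q - p) \<bullet> b')" for q
    using dual(2) by (simp_all add: \<Psi>_def dual_bases_def inner_add_left)
  moreover have "homeomorphism U V \<Psi> G"
  proof
    show "continuous_on U \<Psi>" "continuous_on V G"
      using \<open>smooth_on U \<Psi>\<close> \<open>smooth_on V G\<close> by (simp_all add: smooth_on_continuous_on)
    show "\<Psi> ` U \<subseteq> V"
      using Q_S by (auto simp: U_def V_def U0_def V0_def \<Psi>U)
    show "G ` V \<subseteq> U"
      by (auto simp: U_def V_def U0_def V0_def GV D_Q)
    show "G (\<Psi> q) = q" if "q \<in> U" for q
    proof -
      have "G (\<Psi> q) = p + (((q - p) \<bullet> a') *\<^sub>R a + ((q - p) \<bullet> b') *\<^sub>R b)"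
        using Q_S[of "(q - p) \<bullet> a'" "(q - p) \<bullet> b'"] that
        unfolding G_def \<Psi>U by (simp add: U_def U0_def)
      then show ?thesis using dual(1) by (simp add: dual_bases_def)
    qed
    show "\<Psi> (G v) = v" if "v \<in> V" for v
      using S_Q[of "v \<bullet> k1" "v \<bullet> k2"] that dual(2)
      unfolding \<Psi>_def GV by (simp add: V_def V0_def dual_bases_def)
  qed
  moreover have "p \<in> U" using assms(1) P[of 0] C by (simp add: U_def U0_def D_def)
  ultimately have "diffeo_germ p \<Psi>"
    unfolding diffeo_germ_def using oU oV by blast
  moreover have "\<Psi> p = 0" using C by (simp add: \<Psi>_def S_def)
  moreover have "\<Psi> (p + z *\<^sub>R a + Q z w *\<^sub>R b) = z *\<^sub>R k1 + w *\<^sub>R k2"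
    if "z \<in> ball 0 d" "P z + 2 * r z * w > 0" for z w
    using S_Q[OF that] GV[of "z *\<^sub>R k1 + w *\<^sub>R k2"] dual(2)
    by (simp add: \<Psi>_def G_def dual_bases_def inner_add_left)
  ultimately show thesis using that unfolding Q_def by blast
qed

section \<open>Order of contact\<close>

lemma differentiable_imp_norm_diff_bound:
  fixes f :: "'a::real_normed_vector \<Rightarrow> 'b::real_normed_vector"
  assumes "f differentiable (at x)"
  obtains L where "0 < L" "\<forall>\<^sub>F y in nhds x. norm (f y - f x) \<le> L * norm (y - x)"
proof -
  obtain f' where f': "bounded_linear f'"
    "\<And>e. e > 0 \<Longrightarrow> \<exists>d>0. \<forall>y. norm (y - x) < d \<longrightarrow> norm (f y - f x - f' (y - x)) \<le> e * norm (y - x)"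
    using assms unfolding differentiable_def has_derivative_at_alt by blast
  obtain K where K: "0 < K" "\<And>v. norm (f' v) \<le> norm v * K"
    using bounded_linear.pos_bounded[OF f'(1)] by blast
  obtain d where d: "d > 0" "\<And>y. norm (y - x) < d \<Longrightarrow> norm (f y - f x - f' (y - x)) \<le> norm (y - x)"
    using f'(2)[of 1] by auto
  have "norm (f y - f x) \<le> (K + 1) * norm (y - x)" if "norm (y - x) < d" for y
  proof -
    have "norm (f y - f x) \<le> norm (f y - f x - f' (y - x)) + norm (f' (y - x))"
      by (metis diff_add_cancel norm_triangle_ineq)
    also have "\<dots> \<le> (K + 1) * norm (y - x)"
      using d(2)[OF that] K(2)[of "y - x"] by (simp add: algebra_simps)
    finally show ?thesis .
  qed
  then have "\<forall>\<^sub>F y in nhds x. norm (f y - f x) \<le> (K + 1) * norm (y - x)"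
    unfolding eventually_nhds_metric using d(1) by (auto simp: dist_norm)
  with that[of "K + 1"] K(1) show thesis by simp
qed

lemma smooth_on_differentiable: "smooth_on U f \<Longrightarrow> x \<in> U \<Longrightarrow> f differentiable (at x)"
  using smooth_onD[of U f "Suc 0"] by simp

text \<open>The facts on which the size estimates rest: differentiability in both directions at the
  base points and the inverse relations nearby.\<close>

lemma diffeo_germ_inverse:
  assumes "diffeo_germ p f"
  obtains g where "g (f p) = p" "f differentiable (at p)" "g differentiable (at (f p))"
    "\<forall>\<^sub>F x in nhds p. g (f x) = x" "\<forall>\<^sub>F y in nhds (f p). f (g y) = y"
proof -
  obtain U V g where U: "open U" "p \<in> U" "open V" "homeomorphism U V f g" "smooth_on U f" "smooth_on V g"
    using assms unfolding diffeo_germ_def by blast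
  have V: "f p \<in> V" and inv: "\<And>x. x \<in> U \<Longrightarrow> g (f x) = x" "\<And>y. y \<in> V \<Longrightarrow> f (g y) = y"
    using U(2,4) unfolding homeomorphism_def by blast+
  show thesis
  proof (rule that)
    show "\<forall>\<^sub>F x in nhds p. g (f x) = x"
      using eventually_nhds_in_open[OF U(1,2)] by eventually_elim (rule inv)
    show "\<forall>\<^sub>F y in nhds (f p). f (g y) = y"
      using eventually_nhds_in_open[OF U(3) V] by eventually_elim (rule inv)
  qed (use inv U V smooth_on_differentiable in blast)+
qed

lemma tendsto_nhds_differentiable:
  "f differentiable (at x) \<Longrightarrow> (f \<longlongrightarrow> f x) (nhds x)"
  using differentiable_imp_continuous_within[of f x UNIV]
  by (simp add: continuous_within tendsto_at_iff_tendsto_nhds)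

text \<open>The model has size comparable to \<open>\<bar>t\<bar> ^ k\<close>. A diffeomorphism and
  its inverse change distances from the base point by at most bounded factors, so the comparison
  survives coordinate changes in source and target.\<close>

lemma becomes_order:
  fixes h :: "real \<Rightarrow> real"
  assumes "becomes f (\<lambda>t. vector [t ^ k, t ^ k * h t])" "isCont h 0" "k \<noteq> 0"
  obtains c C where "0 < c" "\<forall>\<^sub>F u in nhds 0. c * \<bar>u\<bar> ^ k \<le> norm (f u - f 0)"
    "\<forall>\<^sub>F u in nhds 0. norm (f u - f 0) \<le> C * \<bar>u\<bar> ^ k"
proof -
  let ?g = "\<lambda>t. vector [t ^ k, t ^ k * h t] :: real^2"
  obtain \<phi> \<Psi> where \<phi>: "diffeo_germ 0 \<phi>" "\<phi> 0 = 0" and \<Psi>: "diffeo_germ (f 0) \<Psi>" "\<Psi> (f 0) = ?g 0"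
    and eq: "\<forall>\<^sub>F t in nhds 0. \<Psi> (f (\<phi> t)) = ?g t" and f: "smooth_germ 0 f"
    using assms(1) unfolding becomes_def by blast
  have g0: "?g 0 = 0" using assms(3) by (simp add: vec_eq_iff forall_2)
  from diffeo_germ_inverse[OF \<phi>(1)] obtain \<psi> where \<psi>: "\<psi> 0 = 0" "\<phi> differentiable (at 0)"
    "\<psi> differentiable (at 0)" "\<forall>\<^sub>F u in nhds 0. \<phi> (\<psi> u) = u"
    unfolding \<phi>(2) by blast
  from diffeo_germ_inverse[OF \<Psi>(1)] obtain G where G: "G 0 = f 0" "\<Psi> differentiable (at (f 0))"
    "G differentiable (at 0)" "\<forall>\<^sub>F q in nhds (f 0). G (\<Psi> q) = q"
    unfolding \<Psi>(2) g0 by blast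
  have "f differentiable (at 0)"
    using f smooth_on_differentiable unfolding smooth_germ_def by blast
  from tendsto_nhds_differentiable[OF this] have limf: "(f \<longlongrightarrow> f 0) (nhds 0)" .
  have lim\<psi>: "(\<psi> \<longlongrightarrow> 0) (nhds 0)"
    using tendsto_nhds_differentiable[OF \<psi>(3)] \<psi>(1) by simp
  have limh: "(h \<longlongrightarrow> h 0) (nhds 0)"
    using assms(2) by (simp add: continuous_at tendsto_at_iff_tendsto_nhds)
  have lim\<Psi>: "((\<lambda>u. \<Psi> (f u)) \<longlongrightarrow> 0) (nhds 0)"
    using filterlim_compose[OF tendsto_nhds_differentiable[OF G(2)] limf] \<Psi>(2) g0 by simp
  obtain L1 where L1: "0 < L1" "\<forall>\<^sub>F q in nhds (f 0). norm (\<Psi> q - \<Psi> (f 0)) \<le> L1 * norm (q - f 0)"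
    using differentiable_imp_norm_diff_bound[OF G(2)] .
  obtain L2 where L2: "0 < L2" "\<forall>\<^sub>F q in nhds 0. norm (G q - G 0) \<le> L2 * norm (q - 0)"
    using differentiable_imp_norm_diff_bound[OF G(3)] .
  obtain L3 where L3: "0 < L3" "\<forall>\<^sub>F t in nhds 0. norm (\<phi> t - \<phi> 0) \<le> L3 * norm (t - 0)"
    using differentiable_imp_norm_diff_bound[OF \<psi>(2)] .
  obtain L4 where L4: "0 < L4" "\<forall>\<^sub>F u in nhds 0. norm (\<psi> u - \<psi> 0) \<le> L4 * norm (u - 0)"
    using differentiable_imp_norm_diff_bound[OF \<psi>(3)] .
  define M where "M = \<bar>h 0\<bar> + 2"
  have M: "\<forall>\<^sub>F t in nhds 0. \<bar>h t\<bar> < \<bar>h 0\<bar> + 1"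
    using tendsto_rabs[OF limh] by (rule order_tendstoD) simp
  \<comment> \<open>All local statements are pulled back to the parameter \<open>u\<close> of
    \<open>f\<close> through \<open>t = \<psi> u\<close>.\<close>
  have ev: "\<forall>\<^sub>F u in nhds 0. \<phi> (\<psi> u) = u \<and> \<Psi> (f (\<phi> (\<psi> u))) = ?g (\<psi> u) \<and>
      \<bar>h (\<psi> u)\<bar> < \<bar>h 0\<bar> + 1 \<and> G (\<Psi> (f u)) = f u \<and>
      norm (\<Psi> (f u)) \<le> L1 * norm (f u - f 0) \<and> norm (G (\<Psi> (f u)) - f 0) \<le> L2 * norm (\<Psi> (f u)) \<and>
      \<bar>\<phi> (\<psi> u)\<bar> \<le> L3 * \<bar>\<psi> u\<bar> \<and> \<bar>\<psi> u\<bar> \<le> L4 * \<bar>u\<bar>"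
    using \<psi>(4) filterlim_iff[THEN iffD1, OF lim\<psi>, rule_format, OF eq]
      filterlim_iff[THEN iffD1, OF lim\<psi>, rule_format, OF M]
      filterlim_iff[THEN iffD1, OF limf, rule_format, OF G(4)]
      filterlim_iff[THEN iffD1, OF limf, rule_format, OF L1(2)]
      filterlim_iff[THEN iffD1, OF lim\<Psi>, rule_format, OF L2(2)]
      filterlim_iff[THEN iffD1, OF lim\<psi>, rule_format, OF L3(2)] L4(2)
    by eventually_elim (simp add: \<Psi>(2) g0 G(1) \<psi>(1) \<phi>(2))
  have bounds: "1 / (L3 ^ k * L1) * \<bar>u\<bar> ^ k \<le> norm (f u - f 0) \<and>
      norm (f u - f 0) \<le> L2 * M * L4 ^ k * \<bar>u\<bar> ^ k"
    if u: "\<phi> (\<psi> u) = u" "\<Psi> (f (\<phi> (\<psi> u))) = ?g (\<psi> u)" "\<bar>h (\<psi> u)\<bar> < \<bar>h 0\<bar> + 1" "G (\<Psi> (f u)) = f u"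
      "norm (\<Psi> (f u)) \<le> L1 * norm (f u - f 0)" "norm (G (\<Psi> (f u)) - f 0) \<le> L2 * norm (\<Psi> (f u))"
      "\<bar>\<phi> (\<psi> u)\<bar> \<le> L3 * \<bar>\<psi> u\<bar>" "\<bar>\<psi> u\<bar> \<le> L4 * \<bar>u\<bar>" for u
  proof
    let ?t = "\<psi> u"
    have \<Psi>u: "\<Psi> (f u) = ?g ?t" using u by simp
    \<comment> \<open>Lower bound: \<open>u\<close> is controlled by \<open>t\<close>, the power
      \<open>t ^ k\<close> is the first coordinate of the model, and \<open>\<Psi>\<close> controls
      the model by \<open>f u - f 0\<close>.\<close>
    have "\<bar>u\<bar> ^ k \<le> (L3 * \<bar>?t\<bar>) ^ k" using u(1,7) by (intro power_mono) auto
    also have "\<dots> = L3 ^ k * \<bar>?g ?t $ 1\<bar>" by (simp add: power_mult_distrib power_abs)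
    also have "\<dots> \<le> L3 ^ k * norm (?g ?t)"
      using L3(1) by (intro mult_left_mono component_le_norm_cart) auto
    also have "\<dots> \<le> L3 ^ k * (L1 * norm (f u - f 0))"
      using L3(1) u(5) unfolding \<Psi>u by (intro mult_left_mono) auto
    finally show "1 / (L3 ^ k * L1) * \<bar>u\<bar> ^ k \<le> norm (f u - f 0)"
      using L1(1) L3(1) by (simp add: field_simps)
    \<comment> \<open>Upper bound: the chain runs through the inverses \<open>G\<close> and
      \<open>\<psi>\<close>, and \<open>M\<close> bounds the two coordinates together.\<close>
    have "norm (?g ?t) \<le> \<bar>?g ?t $ 1\<bar> + \<bar>?g ?t $ 2\<bar>"
      using norm_le_l1_cart[of "?g ?t"] by (simp add: sum_2)
    also have "\<dots> = \<bar>?t\<bar> ^ k * (1 + \<bar>h ?t\<bar>)"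
      by (simp add: abs_mult power_abs algebra_simps)
    also have "\<dots> \<le> (L4 * \<bar>u\<bar>) ^ k * M"
      using u(3,8) by (intro mult_mono power_mono) (auto simp: M_def)
    finally have "L2 * norm (?g ?t) \<le> L2 * ((L4 * \<bar>u\<bar>) ^ k * M)"
      using L2(1) by (intro mult_left_mono) auto
    moreover have "norm (f u - f 0) \<le> L2 * norm (?g ?t)" using u(4,6) \<Psi>u by simp
    ultimately show "norm (f u - f 0) \<le> L2 * M * L4 ^ k * \<bar>u\<bar> ^ k"
      by (simp add: power_mult_distrib mult_ac)
  qed
  show thesis
  proof
    show "0 < 1 / (L3 ^ k * L1)" using L1 L3 by simp
    show "\<forall>\<^sub>F u in nhds 0. 1 / (L3 ^ k * L1) * \<bar>u\<bar> ^ k \<le> norm (f u - f 0)"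
      using ev by eventually_elim (use bounds in blast)
    show "\<forall>\<^sub>F u in nhds 0. norm (f u - f 0) \<le> L2 * M * L4 ^ k * \<bar>u\<bar> ^ k"
      using ev by eventually_elim (use bounds in blast)
  qed
qed

text \<open>Were \<open>k > j\<close>, division by \<open>\<bar>u\<bar> ^ j\<close> and passage to
  the limit at 0 would give \<open>c \<le> 0\<close>.\<close>

lemma power_bound_imp_le:
  fixes c C :: real
  assumes "0 < c" "\<forall>\<^sub>F u in nhds 0. c * \<bar>u\<bar> ^ j \<le> C * \<bar>u\<bar> ^ k"
  shows "k \<le> j"
proof (rule ccontr)
  assume "\<not> k \<le> j"
  then obtain i where i: "k = j + Suc i" using less_imp_Suc_add[of j k] by auto
  have "\<forall>\<^sub>F u in at 0. c \<le> C * \<bar>u\<bar> ^ Suc i"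
    unfolding eventually_at_filter using assms(2)
  proof eventually_elim
    case (elim u)
    have "c * \<bar>u\<bar> ^ j \<le> C * \<bar>u\<bar> ^ Suc i * \<bar>u\<bar> ^ j"
      using elim by (simp add: i power_add mult_ac)
    then show ?case by (auto dest: mult_right_le_imp_le)
  qed
  moreover have "((\<lambda>u::real. C * \<bar>u\<bar> ^ Suc i) \<longlongrightarrow> C * \<bar>0\<bar> ^ Suc i) (at 0)"
    by (intro tendsto_intros)
  ultimately have "c \<le> C * \<bar>0\<bar> ^ Suc i"
    using tendsto_lowerbound[of _ _ "at (0::real)" c] by simp
  then show False using assms(1) by simp
qed

section \<open>Normal forms of cusps\<close>

lemma smooth_on_pos_ball:
  fixes h :: "real \<Rightarrow> real"
  assumes "0 < e" "smooth_on (ball 0 e) h" "h 0 > 0"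
  obtains d where "0 < d" "d \<le> e" "\<And>x. x \<in> ball 0 d \<Longrightarrow> h x > 0"
proof -
  have "open (ball 0 e \<inter> h -` {0<..})"
    by (intro continuous_open_preimage smooth_on_continuous_on assms open_ball open_greaterThan)
  moreover have "0 \<in> ball 0 e \<inter> h -` {0<..}" using assms by simp
  ultimately obtain d where d: "0 < d" "ball 0 d \<subseteq> ball 0 e \<inter> h -` {0<..}" by (rule openE)
  have "d \<le> e" using d by (simp add: ball_subset_ball_iff)
  moreover have "h x > 0" if "x \<in> ball 0 d" for x using d(2) that by blast
  ultimately show thesis using that d(1) by blast
qed

lemma DERIV_mult_self_0:
  fixes g :: "real \<Rightarrow> real"
  assumes "0 < e" "smooth_on (ball 0 e) g"
  shows "((\<lambda>u. u * g u) has_real_derivative g 0) (at 0)"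
  by (rule DERIV_cong[OF DERIV_mult[OF DERIV_ident
        smooth_on_has_real_derivative[OF open_ball assms(2)]]]) (use assms(1) in auto)

text \<open>Beyond 4, only the exponent 5 is missing from the semigroup generated by 3 and 4. For
  \<open>n = 4\<close> the condition on derivatives says that the second coordinate has no term of
  order 5 once the first is exactly \<open>t ^ 3\<close>; for \<open>n = 2\<close> there is no such
  gap. The orthonormal pair \<open>k1\<close>, \<open>k2\<close> leaves open which target axis
  carries the cube.\<close>

lemma becomes_cubic_normal_form:
  fixes f :: "real \<Rightarrow> real^2"
  assumes f: "smooth_germ 0 f" and "0 < e"
    and A: "smooth_on (ball 0 e) A" "A 0 = 1" and B: "smooth_on (ball 0 e) B" "B 0 = 1"
    and eq: "\<And>u. u \<in> ball 0 e \<Longrightarrow> f u = f 0 + (u ^ 3 * A u) *\<^sub>R a + (u ^ n * B u) *\<^sub>R b"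
    and ab: "det2 a b \<noteq> 0" and k: "dual_bases k1 k2 k1 k2"
    and n: "n = 2 \<or> n = 4 \<and> 4 * deriv A 0 = 3 * deriv B 0"
  shows "becomes f (\<lambda>t. t ^ 3 *\<^sub>R k1 + t ^ n *\<^sub>R k2)"
proof -
  obtain e1 where e1: "0 < e1" "e1 \<le> e" "\<And>u. u \<in> ball 0 e1 \<Longrightarrow> A u > 0"
    using smooth_on_pos_ball[OF \<open>0 < e\<close> A(1)] A(2) by auto
  have sub1: "ball 0 e1 \<subseteq> ball (0::real) e" using e1(2) by (rule subset_ball)
  have sA: "smooth_on (ball 0 e1) A" and sB: "smooth_on (ball 0 e1) B"
    using smooth_on_subset[OF A(1) sub1] smooth_on_subset[OF B(1) sub1] .
  have sP: "smooth_on (ball 0 e1) (\<lambda>u. A u powr x)" for x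
    by (rule smooth_on_powr[OF open_ball sA e1(3)])
  \<comment> \<open>Chosen so that \<open>\<tau> u ^ 3 = u ^ 3 * A u\<close>; its inverse
    \<open>\<phi>\<close> is the change of parameter.\<close>
  define \<tau> where "\<tau> = (\<lambda>u. u * A u powr (1 / 3))"
  have s\<tau>: "smooth_on (ball 0 e1) \<tau>"
    unfolding \<tau>_def by (intro smooth_on_intros open_ball sP)
  have D\<tau>: "(\<tau> has_real_derivative 1) (at 0)"
    using DERIV_mult_self_0[OF e1(1) sP[of "1 / 3"]] A(2) by (simp add: \<tau>_def)
  obtain d V \<phi> where d: "0 < d" "d \<le> e1" and V: "open V" and hom: "homeomorphism (ball 0 d) V \<tau> \<phi>"
    and s\<phi>: "smooth_on V \<phi>"
    using smooth_local_inverse[OF e1(1) s\<tau>] DERIV_imp_deriv[OF D\<tau>] by auto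
  have subd: "ball 0 d \<subseteq> ball (0::real) e1" using d(2) by (rule subset_ball)
  have \<tau>0: "\<tau> 0 = 0" by (simp add: \<tau>_def)
  have \<phi>\<tau>: "\<tau> u \<in> V \<and> \<phi> (\<tau> u) = u" if "u \<in> ball 0 d" for u
    using hom that unfolding homeomorphism_def by blast
  have \<tau>\<phi>: "\<phi> t \<in> ball 0 d \<and> \<tau> (\<phi> t) = t" if "t \<in> V" for t
    using hom that unfolding homeomorphism_def by blast
  have V0: "0 \<in> V" and \<phi>0: "\<phi> 0 = 0"
    using \<phi>\<tau>[of 0] d(1) \<tau>0 by auto
  \<comment> \<open>The negative exponent cancels the powers of \<open>A\<close> that
    \<open>t ^ n\<close> brings in, so that \<open>t ^ n * R t\<close> is the second coordinate in
    the parameter \<open>t\<close>.\<close>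
  define R where "R = (\<lambda>t. B (\<phi> t) * A (\<phi> t) powr (- (real n / 3)))"
  have sR: "smooth_on V R"
    unfolding R_def
    by (intro smooth_on_mult V smooth_on_compose[OF sB open_ball V s\<phi>]
        smooth_on_compose[OF sP open_ball V s\<phi>]) (use \<tau>\<phi> subd in blast)+
  have R0: "R 0 = 1" by (simp add: R_def \<phi>0 A(2) B(2))
  have powA: "(A u powr (1 / 3)) ^ i = A u powr (real i / 3)" if "u \<in> ball 0 d" for u i
    using e1(3)[of u] subd that by (auto simp: powr_power)
  have t3: "t ^ 3 = \<phi> t ^ 3 * A (\<phi> t)" and tn: "t ^ n * R t = \<phi> t ^ n * B (\<phi> t)" if "t \<in> V" for t
  proof -
    define u where "u = \<phi> t"
    have u: "u \<in> ball 0 d" "t = u * A u powr (1 / 3)" "A u > 0"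
      using \<tau>\<phi>[OF that] e1(3)[of u] subd by (auto simp: u_def \<tau>_def)
    show "t ^ 3 = \<phi> t ^ 3 * A (\<phi> t)"
      unfolding u_def[symmetric] using u(3) by (simp add: u(2) power_mult_distrib powA[OF u(1)])
    have "t ^ n * R t = u ^ n * B u * (A u powr (real n / 3) * A u powr (- (real n / 3)))"
      unfolding R_def u_def[symmetric]
      by (subst u(2)) (simp only: power_mult_distrib powA[OF u(1)] mult_ac)
    also have "A u powr (real n / 3) * A u powr (- (real n / 3)) = 1"
      using u(3) by (simp flip: powr_add)
    finally show "t ^ n * R t = \<phi> t ^ n * B (\<phi> t)" by (simp add: u_def)
  qed
  obtain \<epsilon>0 where "0 < \<epsilon>0" "ball 0 \<epsilon>0 \<subseteq> V" using openE[OF V V0] .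
  define \<epsilon> where "\<epsilon> = min 1 \<epsilon>0"
  have \<epsilon>: "0 < \<epsilon>" "\<epsilon> \<le> 1" "ball 0 \<epsilon> \<subseteq> V"
    using \<open>0 < \<epsilon>0\<close> \<open>ball 0 \<epsilon>0 \<subseteq> V\<close> by (auto simp: \<epsilon>_def)
  obtain r0 r1 r2 where r: "smooth_on (ball 0 (\<epsilon> ^ 3)) r0" "smooth_on (ball 0 (\<epsilon> ^ 3)) r1"
      "smooth_on (ball 0 (\<epsilon> ^ 3)) r2"
    and Req: "\<And>t. t \<in> ball 0 \<epsilon> \<Longrightarrow> R t = r0 (t ^ 3) + t * r1 (t ^ 3) + t\<^sup>2 * r2 (t ^ 3)"
    using cubic_division[OF \<epsilon>(1,2) smooth_on_subset[OF sR \<epsilon>(3)]] by blast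
  have r00: "r0 0 = 1" using Req[of 0] \<epsilon>(1) R0 by simp
  have \<epsilon>3: "0 < \<epsilon> ^ 3" using \<epsilon>(1) by simp
  have cube: "t ^ 3 \<in> ball 0 (\<epsilon> ^ 3)" if "t \<in> ball 0 \<epsilon>" for t :: real
    using that power_strict_mono[of "\<bar>t\<bar>" \<epsilon> 3] by (simp add: power_abs)
  have s3: "smooth_on (ball 0 \<epsilon>) (\<lambda>t. h (t ^ 3))" if "smooth_on (ball 0 (\<epsilon> ^ 3)) h" for h :: "real \<Rightarrow> real"
    by (rule smooth_on_compose[OF that open_ball open_ball _ cube]) (intro smooth_on_intros open_ball)
  \<comment> \<open>With \<open>z = t ^ 3\<close> and \<open>w = t ^ n\<close>, the three terms of
    the division regroup as a quadratic in \<open>w\<close>.\<close>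
  obtain P C r where PCr: "smooth_on (ball 0 (\<epsilon> ^ 3)) P" "smooth_on (ball 0 (\<epsilon> ^ 3)) C"
      "smooth_on (ball 0 (\<epsilon> ^ 3)) r" "P 0 = 1" "C 0 = 0"
    and PCreq: "\<And>t. t \<in> ball 0 \<epsilon> \<Longrightarrow> t ^ n * R t = t ^ n * P (t ^ 3) + C (t ^ 3) + (t ^ n)\<^sup>2 * r (t ^ 3)"
    using n
  proof (elim disjE conjE)
    assume n2: "n = 2"
    show thesis
    \<comment> \<open>Here \<open>t ^ 3 * r1 (t ^ 3)\<close> depends on \<open>z\<close> alone, and
      \<open>t ^ 4 * r2 (t ^ 3)\<close> contains \<open>w\<^sup>2\<close>.\<close>
    proof (rule that[OF r(1) _ r(3) r00])
      show "smooth_on (ball 0 (\<epsilon> ^ 3)) (\<lambda>z. z * r1 z)"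
        by (intro smooth_on_intros r open_ball)
      show "t ^ n * R t = t ^ n * r0 (t ^ 3) + t ^ 3 * r1 (t ^ 3) + (t ^ n)\<^sup>2 * r2 (t ^ 3)"
        if "t \<in> ball 0 \<epsilon>" for t
        unfolding Req[OF that] n2 by (simp add: algebra_simps power2_eq_square power3_eq_cube)
    qed simp
  next
    assume n4: "n = 4" and AB: "4 * deriv A 0 = 3 * deriv B 0"
    \<comment> \<open>\<open>r1 0\<close> is the derivative of \<open>R\<close> at 0. As
      \<open>\<tau>\<close> has derivative 1 there, it can be computed in the parameter
      \<open>u\<close>, where it is \<open>deriv B 0 - 4 / 3 * deriv A 0\<close>.\<close>
    have "r1 0 = 0"
    proof -
      have in0: "0 \<in> ball (0::real) e1" "0 \<in> ball (0::real) (\<epsilon> ^ 3)" using e1(1) \<epsilon>3 by auto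
      have "smooth_on (ball 0 \<epsilon>) (\<lambda>t. r1 (t ^ 3) + t * r2 (t ^ 3))"
        by (intro smooth_on_intros s3 r open_ball)
      from DERIV_mult_self_0[OF \<epsilon>(1) this]
      have D2: "((\<lambda>t. t * (r1 (t ^ 3) + t * r2 (t ^ 3))) has_real_derivative r1 0) (at 0)" by simp
      have "(r0 has_real_derivative deriv r0 0) (at (0 ^ 3))"
        using smooth_on_has_real_derivative[OF open_ball r(1) in0(2)] by simp
      from DERIV_add[OF DERIV_chain2[OF this DERIV_pow[of 3 0]] D2]
      have "((\<lambda>t. r0 (t ^ 3) + t * (r1 (t ^ 3) + t * r2 (t ^ 3))) has_real_derivative r1 0) (at 0)"
        by simp
      then have "(R has_real_derivative r1 0) (at 0)"
        by (rule has_field_derivative_transform_within_open[OF _ open_ball, of _ _ _ 0 \<epsilon>, simplified])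
          (use \<epsilon>(1) Req in \<open>auto simp: algebra_simps power2_eq_square\<close>)
      then have "((\<lambda>u. R (\<tau> u)) has_real_derivative r1 0) (at 0)"
        using DERIV_chain2[of R "r1 0" \<tau> 0 1] D\<tau> \<tau>0 by simp
      then have "((\<lambda>u. B u * A u powr (- 4 / 3)) has_real_derivative r1 0) (at 0)"
        by (rule has_field_derivative_transform_within_open[OF _ open_ball, of _ _ _ 0 d, simplified])
          (use d(1) \<phi>\<tau> in \<open>auto simp: R_def n4\<close>)
      moreover have "((\<lambda>u. B u * A u powr (- 4 / 3)) has_real_derivative
          deriv B 0 - 4 / 3 * deriv A 0) (at 0)"
        using smooth_on_has_real_derivative[OF open_ball sA in0(1)]
          smooth_on_has_real_derivative[OF open_ball sB in0(1)] A(2) B(2)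
        by (auto intro!: derivative_eq_intros)
      ultimately show ?thesis using DERIV_unique AB by fastforce
    qed
    then obtain s1 where s1: "smooth_on (ball 0 (\<epsilon> ^ 3)) s1"
      "\<And>z. z \<in> ball 0 (\<epsilon> ^ 3) \<Longrightarrow> r1 z = z * s1 z"
      using smooth_on_Taylor[OF \<epsilon>3 r(2), of 1] by auto
    show thesis
    \<comment> \<open>With \<open>r1 z = z * s1 z\<close> the term of exponent 5 becomes
      \<open>w\<^sup>2 * s1 z\<close>, while that of exponent 6 is
      \<open>z\<^sup>2 * r2 z\<close>.\<close>
    proof (rule that[OF r(1) _ s1(1) r00])
      show "smooth_on (ball 0 (\<epsilon> ^ 3)) (\<lambda>z. z\<^sup>2 * r2 z)"
        by (intro smooth_on_intros r open_ball)
      show "t ^ n * R t = t ^ n * r0 (t ^ 3) + (t ^ 3)\<^sup>2 * r2 (t ^ 3) + (t ^ n)\<^sup>2 * s1 (t ^ 3)"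
        if "t \<in> ball 0 \<epsilon>" for t
        unfolding Req[OF that] s1(2)[OF cube[OF that]] n4
        by (simp add: algebra_simps flip: power_mult power_add) (simp add: eval_nat_numeral algebra_simps)
    qed simp
  qed
  obtain d2 where d2: "0 < d2" "d2 \<le> \<epsilon> ^ 3" "\<And>z. z \<in> ball 0 d2 \<Longrightarrow> P z > 0"
    using smooth_on_pos_ball[OF \<epsilon>3 PCr(1)] PCr(4) by auto
  have sub2: "ball 0 d2 \<subseteq> ball (0::real) (\<epsilon> ^ 3)" using d2(2) by (rule subset_ball)
  obtain a' b' where ab': "dual_bases a b a' b'" using ex_dual_bases[OF ab] .
  obtain \<Psi> where \<Psi>: "diffeo_germ (f 0) \<Psi>" "\<Psi> (f 0) = 0"
    "\<And>z w. z \<in> ball 0 d2 \<Longrightarrow> P z + 2 * r z * w > 0 \<Longrightarrow>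
      \<Psi> (f 0 + z *\<^sub>R a + (w * P z + C z + w\<^sup>2 * r z) *\<^sub>R b) = z *\<^sub>R k1 + w *\<^sub>R k2"
    using quadratic_diffeo_germ[OF d2(1) ab' k smooth_on_subset[OF PCr(1) sub2]
        smooth_on_subset[OF PCr(2) sub2] smooth_on_subset[OF PCr(3) sub2] d2(3) PCr(5)] by blast
  have "n \<noteq> 0" using n by auto
  \<comment> \<open>The derivative of the quadratic in \<open>w\<close> along the curve. It equals 1
    at 0, and its positivity selects the root \<open>w = t ^ n\<close>.\<close>
  have "smooth_on (ball 0 \<epsilon>) (\<lambda>t. P (t ^ 3) + 2 * r (t ^ 3) * t ^ n)"
    by (intro smooth_on_intros s3 PCr open_ball)
  from smooth_on_pos_ball[OF \<epsilon>(1) this] obtain \<delta> where \<delta>: "0 < \<delta>" "\<delta> \<le> \<epsilon>"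
    "\<And>t. t \<in> ball 0 \<delta> \<Longrightarrow> P (t ^ 3) + 2 * r (t ^ 3) * t ^ n > 0"
    using PCr(4) \<open>n \<noteq> 0\<close> by (auto simp: power_0_left)
  have "\<Psi> (f (\<phi> t)) = t ^ 3 *\<^sub>R k1 + t ^ n *\<^sub>R k2" if t: "t \<in> ball 0 (min \<delta> d2)" for t
  proof -
    have "\<bar>t\<bar> < \<delta>" "\<bar>t\<bar> < d2" using t by auto
    moreover have "\<bar>t\<bar> ^ 3 \<le> \<bar>t\<bar>"
      using \<open>\<bar>t\<bar> < \<delta>\<close> \<delta>(2) \<epsilon>(2) power_decreasing[of 1 3 "\<bar>t\<bar>"] by simp
    ultimately have t': "t \<in> ball 0 \<delta>" "t ^ 3 \<in> ball 0 d2" "t \<in> ball 0 \<epsilon>"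
      using \<delta>(2) by (auto simp: power_abs)
    then have tV: "t \<in> V" using \<epsilon>(3) by blast
    have "\<phi> t \<in> ball 0 e" using \<tau>\<phi>[OF tV] subd sub1 by blast
    then have "f (\<phi> t) = f 0 + t ^ 3 *\<^sub>R a +
        (t ^ n * P (t ^ 3) + C (t ^ 3) + (t ^ n)\<^sup>2 * r (t ^ 3)) *\<^sub>R b"
      using eq[of "\<phi> t"] t3[OF tV] tn[OF tV] PCreq[OF t'(3)] by simp
    then show ?thesis using \<Psi>(3)[OF t'(2) \<delta>(3)[OF t'(1)]] by simp
  qed
  moreover have "0 < min \<delta> d2" using \<delta>(1) d2(1) by simp
  ultimately have "\<forall>\<^sub>F t in nhds 0. \<Psi> (f (\<phi> t)) = t ^ 3 *\<^sub>R k1 + t ^ n *\<^sub>R k2"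
    by (auto simp: eventually_nhds_metric intro!: exI[of _ "min \<delta> d2"])
  moreover have "diffeo_germ 0 \<phi>"
    unfolding diffeo_germ_def
    using V V0 homeomorphism_sym[THEN iffD1, OF hom] s\<phi> smooth_on_subset[OF s\<tau> subd] open_ball by blast
  ultimately show ?thesis
    unfolding becomes_def using f \<phi>0 \<Psi>(1,2) \<open>n \<noteq> 0\<close> by (auto simp: power_0_left)
qed

section \<open>Criteria for 3/2- and 4/3-cusps\<close>

lemma dual_bases_axis: "dual_bases (axis 1 1) (axis 2 1) (axis 1 1) (axis 2 1)"
  "dual_bases (axis 2 1) (axis 1 1) (axis 2 1) (axis 1 1)"
  by (simp_all add: dual_bases_def inner_vec_def sum_2 vec_eq_iff forall_2 axis_def)

lemma det2_linear:
  "det2 a (b + c) = det2 a b + det2 a c"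
  "det2 (x *\<^sub>R a) b = x * det2 a b" "det2 a (x *\<^sub>R b) = x * det2 a b"
  "det2 a b = - det2 b a"
  by (simp_all add: det2_def det_2 algebra_simps)

lemma det2_self: "det2 a a = 0"
  by (simp add: det2_def det_2)

text \<open>The normal form lists the cubic coordinate first, so \<open>a\<close> and
  \<open>b\<close> exchange roles and the axes come in reverse order. Rescaling both vectors makes
  the leading coefficients 1.\<close>

lemma cusp_3_2I:
  fixes f :: "real \<Rightarrow> real^2"
  assumes f: "smooth_germ 0 f" and e: "0 < e"
    and X: "smooth_on (ball 0 e) X" "X 0 \<noteq> 0" and Y: "smooth_on (ball 0 e) Y" "Y 0 \<noteq> 0"
    and eq: "\<And>u. u \<in> ball 0 e \<Longrightarrow> f u = f 0 + (u\<^sup>2 * X u) *\<^sub>R a + (u ^ 3 * Y u) *\<^sub>R b"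
    and ab: "det2 a b \<noteq> 0"
  shows "cusp_3_2 f"
proof -
  have "becomes f (\<lambda>t. t ^ 3 *\<^sub>R axis 2 1 + t\<^sup>2 *\<^sub>R axis 1 1)"
  proof (rule becomes_cubic_normal_form[OF f e, where A = "\<lambda>u. Y u / Y 0" and B = "\<lambda>u. X u / X 0"
        and a = "Y 0 *\<^sub>R b" and b = "X 0 *\<^sub>R a"])
    show "smooth_on (ball 0 e) (\<lambda>u. Y u / Y 0)" "smooth_on (ball 0 e) (\<lambda>u. X u / X 0)"
      by (intro smooth_on_intros X Y open_ball)+
    show "f u = f 0 + (u ^ 3 * (Y u / Y 0)) *\<^sub>R Y 0 *\<^sub>R b + (u\<^sup>2 * (X u / X 0)) *\<^sub>R X 0 *\<^sub>R a"
      if "u \<in> ball 0 e" for u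
      using X(2) Y(2) unfolding eq[OF that] by simp
    show "det2 (Y 0 *\<^sub>R b) (X 0 *\<^sub>R a) \<noteq> 0"
      using ab X(2) Y(2) det2_linear(4)[of a b] by (simp add: det2_linear(2,3))
  qed (use X(2) Y(2) dual_bases_axis in auto)
  moreover have "(\<lambda>t. t ^ 3 *\<^sub>R axis 2 1 + t\<^sup>2 *\<^sub>R axis 1 1) = (\<lambda>t. vector [t\<^sup>2, t ^ 3] :: real^2)"
    by (simp add: fun_eq_iff vec_eq_iff forall_2 axis_def)
  ultimately show ?thesis by (simp add: cusp_3_2_def)
qed

lemma cusp_4_3I:
  fixes f :: "real \<Rightarrow> real^2"
  assumes f: "smooth_germ 0 f" and e: "0 < e"
    and X: "smooth_on (ball 0 e) X" "X 0 \<noteq> 0" and Y: "smooth_on (ball 0 e) Y" "Y 0 \<noteq> 0"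
    and eq: "\<And>u. u \<in> ball 0 e \<Longrightarrow> f u = f 0 + (u ^ 3 * X u) *\<^sub>R a + (u ^ 4 * Y u) *\<^sub>R b"
    and ab: "det2 a b \<noteq> 0"
  shows "cusp_4_3 f"
proof -
  define A where "A = (\<lambda>u. X u / X 0)"
  define B where "B = (\<lambda>u. Y u / Y 0)"
  have sA: "smooth_on (ball 0 e) A" and sB: "smooth_on (ball 0 e) B"
    unfolding A_def B_def by (intro smooth_on_intros X Y open_ball)+
  have AB0: "A 0 = 1" "B 0 = 1" using X(2) Y(2) by (simp_all add: A_def B_def)
  \<comment> \<open>This shear of the second direction removes the term of order \<open>5\<close>, the only gap of the
    semigroup generated by \<open>3\<close> and \<open>4\<close> above \<open>4\<close>.\<close>
  define k where "k = 3 / 4 * deriv B 0 - deriv A 0"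
  have in0: "0 \<in> ball (0::real) e" using e by simp
  have "becomes f (\<lambda>t. t ^ 3 *\<^sub>R axis 1 1 + t ^ 4 *\<^sub>R axis 2 1)"
  proof (rule becomes_cubic_normal_form[OF f e, where A = "\<lambda>u. A u + k * (u * B u)" and B = B
        and a = "X 0 *\<^sub>R a" and b = "Y 0 *\<^sub>R b + (- k * X 0) *\<^sub>R a"])
    show "smooth_on (ball 0 e) (\<lambda>u. A u + k * (u * B u))"
      by (intro smooth_on_intros sA sB open_ball)
    show "f u = f 0 + (u ^ 3 * (A u + k * (u * B u))) *\<^sub>R X 0 *\<^sub>R a +
        (u ^ 4 * B u) *\<^sub>R (Y 0 *\<^sub>R b + (- k * X 0) *\<^sub>R a)" if "u \<in> ball 0 e" for u
    proof -
      have "X u = A u * X 0" "Y u = B u * Y 0" using X(2) Y(2) by (simp_all add: A_def B_def)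
      then show ?thesis
        unfolding eq[OF that] by (simp add: vec_eq_iff algebra_simps power3_eq_cube power4_eq_xxxx)
    qed
    show "det2 (X 0 *\<^sub>R a) (Y 0 *\<^sub>R b + (- k * X 0) *\<^sub>R a) \<noteq> 0"
      unfolding det2_linear(1,2,3) det2_self using ab X(2) Y(2) by simp
    have "((\<lambda>u. A u + k * (u * B u)) has_real_derivative deriv A 0 + k * B 0) (at 0)"
      by (intro DERIV_add DERIV_cmult DERIV_mult_self_0[OF e sB]
          smooth_on_has_real_derivative[OF open_ball sA in0])
    then show "4 = 2 \<or> 4 = 4 \<and> 4 * deriv (\<lambda>u. A u + k * (u * B u)) 0 = 3 * deriv B 0"
      by (simp add: DERIV_imp_deriv AB0 k_def)
  qed (use AB0 sB dual_bases_axis in auto)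
  moreover have "(\<lambda>t. t ^ 3 *\<^sub>R axis 1 1 + t ^ 4 *\<^sub>R axis 2 1) = (\<lambda>t. vector [t ^ 3, t ^ 4] :: real^2)"
    by (simp add: fun_eq_iff vec_eq_iff forall_2 axis_def)
  ultimately show ?thesis by (simp add: cusp_4_3_def)
qed

text \<open>The velocity component along \<open>D 0\<close> has order \<open>i\<close>. The
  transverse one has order \<open>i + 1\<close>, because the transverse part of \<open>D\<close>
  vanishes at 0 to exactly first order. Integration raises both orders by one.\<close>

lemma frontal_cusp:
  fixes f D :: "real \<Rightarrow> real^2"
  assumes e: "0 < e" and f: "smooth_on (ball 0 e) f" and D: "smooth_on (ball 0 e) D"
    and q: "smooth_on (ball 0 e) q" "q 0 \<noteq> 0"
    and f': "\<And>u. u \<in> ball 0 e \<Longrightarrow> (f has_vector_derivative (u ^ i * q u) *\<^sub>R D u) (at u)"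
    and D0: "(D has_vector_derivative D') (at 0)" and det: "det2 (D 0) D' \<noteq> 0"
  shows "i = 1 \<Longrightarrow> cusp_3_2 f" "i = 2 \<Longrightarrow> cusp_4_3 f"
proof -
  obtain a' b' where dual: "dual_bases (D 0) D' a' b'" using ex_dual_bases[OF det] .
  have germ: "smooth_germ 0 f"
    unfolding smooth_germ_def using f e by (intro exI[of _ "ball 0 e"]) auto
  have sx: "smooth_on (ball 0 e) (\<lambda>u. q u * (D u \<bullet> a'))" and sy: "smooth_on (ball 0 e) (\<lambda>u. D u \<bullet> b')"
    by (intro smooth_on_intros q D open_ball)+
  have y0: "((\<lambda>u. D u \<bullet> b') has_real_derivative 1) (at 0)"
    using bounded_linear.has_vector_derivative[OF bounded_linear_inner_left D0, of b'] dual
    by (simp add: dual_bases_def has_real_derivative_iff_has_vector_derivative)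
  obtain y where y: "smooth_on (ball 0 e) y" "\<And>u. u \<in> ball 0 e \<Longrightarrow> D u \<bullet> b' = u * y u" "y 0 = 1"
    using smooth_on_Taylor[OF e sy, of 1] DERIV_imp_deriv[OF y0] dual by (auto simp: dual_bases_def)
  have comp: "((\<lambda>u. f u \<bullet> v) has_vector_derivative (u ^ i * q u) * (D u \<bullet> v)) (at u)"
    if "u \<in> ball 0 e" for u v
    using bounded_linear.has_vector_derivative[OF bounded_linear_inner_left f'[OF that], of v] by simp
  have "((\<lambda>u. f u \<bullet> a') has_vector_derivative u ^ i *\<^sub>R (q u * (D u \<bullet> a'))) (at u)"
    if "u \<in> ball 0 e" for u
    using comp[OF that, of a'] by (simp add: mult.assoc)
  from antiderivative_factor[OF e sx this]
  obtain X where X: "smooth_on (ball 0 e) X" "X 0 = q 0 * (D 0 \<bullet> a') /\<^sub>R real (Suc i)"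
    "\<And>u. u \<in> ball 0 e \<Longrightarrow> f u \<bullet> a' = f 0 \<bullet> a' + u ^ Suc i *\<^sub>R X u" by blast
  have X0: "X 0 \<noteq> 0" using q(2) dual by (simp add: X(2) dual_bases_def)
  have sqy: "smooth_on (ball 0 e) (\<lambda>u. q u * y u)"
    by (intro smooth_on_intros q y open_ball)
  have "((\<lambda>u. f u \<bullet> b') has_vector_derivative u ^ Suc i *\<^sub>R (q u * y u)) (at u)"
    if "u \<in> ball 0 e" for u
    using comp[OF that, of b'] unfolding y(2)[OF that] by (simp add: mult_ac)
  from antiderivative_factor[OF e sqy this]
  obtain Y where Y: "smooth_on (ball 0 e) Y" "Y 0 = q 0 * y 0 /\<^sub>R real (Suc (Suc i))"
    "\<And>u. u \<in> ball 0 e \<Longrightarrow> f u \<bullet> b' = f 0 \<bullet> b' + u ^ Suc (Suc i) *\<^sub>R Y u" by blast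
  have Y0: "Y 0 \<noteq> 0" using q(2) y(3) by (simp add: Y(2))
  have eq: "f u = f 0 + (u ^ m * X u) *\<^sub>R D 0 + (u ^ n * Y u) *\<^sub>R D'"
    if "u \<in> ball 0 e" "m = Suc i" "n = Suc (Suc i)" for u m n
  proof -
    have rep: "v = (v \<bullet> a') *\<^sub>R D 0 + (v \<bullet> b') *\<^sub>R D'" for v
      using dual by (simp add: dual_bases_def)
    have "f u = (f u \<bullet> a') *\<^sub>R D 0 + (f u \<bullet> b') *\<^sub>R D'" by (rule rep)
    also have "\<dots> = ((f 0 \<bullet> a') *\<^sub>R D 0 + (f 0 \<bullet> b') *\<^sub>R D') +
        (u ^ Suc i * X u) *\<^sub>R D 0 + (u ^ Suc (Suc i) * Y u) *\<^sub>R D'"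
      unfolding X(3)[OF that(1)] Y(3)[OF that(1)] real_scaleR_def scaleR_add_left by (simp only: add_ac)
    also have "(f 0 \<bullet> a') *\<^sub>R D 0 + (f 0 \<bullet> b') *\<^sub>R D' = f 0" by (rule rep[symmetric])
    finally show ?thesis unfolding that(2,3) .
  qed
  show "cusp_3_2 f" if "i = 1"
  proof (rule cusp_3_2I[OF germ e X(1) X0 Y(1) Y0 _ det])
    note i = that
    show "f u = f 0 + (u\<^sup>2 * X u) *\<^sub>R D 0 + (u ^ 3 * Y u) *\<^sub>R D'"
      if "u \<in> ball 0 e" for u
      by (rule eq[OF that]) (simp_all add: i)
  qed
  show "cusp_4_3 f" if "i = 2"
  proof (rule cusp_4_3I[OF germ e X(1) X0 Y(1) Y0 _ det])
    note i = that
    show "f u = f 0 + (u ^ 3 * X u) *\<^sub>R D 0 + (u ^ 4 * Y u) *\<^sub>R D'"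
      if "u \<in> ball 0 e" for u
      by (rule eq[OF that]) (simp_all add: i)
  qed
qed

text \<open>If \<open>j\<close> is the first order in which \<open>\<delta>\<close> has a nonzero
  derivative at 0, then \<open>f u - f 0\<close> has size comparable to
  \<open>\<bar>u\<bar> ^ Suc j\<close>; the two bounds force \<open>j = k\<close>.\<close>

lemma zero_of_order_speed:
  fixes f v :: "real \<Rightarrow> real^2"
  assumes e: "0 < e" and s: "smooth_on (ball 0 e) \<delta>" "smooth_on (ball 0 e) v" "v 0 \<noteq> 0"
    and f': "\<And>u. u \<in> ball 0 e \<Longrightarrow> (f has_vector_derivative \<delta> u *\<^sub>R v u) (at u)"
    and bound: "0 < c" "\<forall>\<^sub>F u in nhds 0. c * \<bar>u\<bar> ^ Suc k \<le> norm (f u - f 0)"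
      "\<forall>\<^sub>F u in nhds 0. norm (f u - f 0) \<le> C * \<bar>u\<bar> ^ Suc k"
  shows "zero_of_order k \<delta>"
proof -
  let ?d = "\<lambda>i. (deriv ^^ i) \<delta> 0"
  have ex: "\<exists>\<beta>. (\<beta> \<longlongrightarrow> \<beta> 0) (nhds 0) \<and> \<beta> 0 = (?d j / fact (Suc j)) *\<^sub>R v 0 \<and>
      (\<forall>\<^sub>F u in nhds 0. norm (f u - f 0) = \<bar>u\<bar> ^ Suc j * norm (\<beta> u))"
    if zero: "\<forall>i<j. ?d i = 0" for j
  proof -
    obtain g where g: "smooth_on (ball 0 e) g" "g 0 = ?d j / fact j"
      "\<And>x. x \<in> ball 0 e \<Longrightarrow> \<delta> x = x ^ j * g x"
      using smooth_on_Taylor[OF e s(1), of j] zero by auto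
    have "smooth_on (ball 0 e) (\<lambda>u. g u *\<^sub>R v u)"
      by (intro smooth_on_intros g s open_ball)
    moreover have "(f has_vector_derivative u ^ j *\<^sub>R g u *\<^sub>R v u) (at u)" if "u \<in> ball 0 e" for u
      using f'[OF that] g(3)[OF that] by simp
    ultimately obtain \<beta> where \<beta>: "smooth_on (ball 0 e) \<beta>" "\<beta> 0 = g 0 *\<^sub>R v 0 /\<^sub>R real (Suc j)"
      "\<And>u. u \<in> ball 0 e \<Longrightarrow> f u = f 0 + u ^ Suc j *\<^sub>R \<beta> u"
      using antiderivative_factor[OF e] by blast
    have "(\<beta> \<longlongrightarrow> \<beta> 0) (nhds 0)"
      using tendsto_nhds_differentiable[OF smooth_on_differentiable[OF \<beta>(1)]] e by simp
    moreover have "norm (f u - f 0) = \<bar>u\<bar> ^ Suc j * norm (\<beta> u)" if "u \<in> ball 0 e" for u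
    proof -
      have "f u - f 0 = u ^ Suc j *\<^sub>R \<beta> u" by (subst \<beta>(3)[OF that]) simp
      then show ?thesis by (simp only: norm_scaleR power_abs)
    qed
    then have "\<forall>\<^sub>F u in nhds 0. norm (f u - f 0) = \<bar>u\<bar> ^ Suc j * norm (\<beta> u)"
      unfolding eventually_nhds using e by (intro exI[of _ "ball 0 e"]) simp
    moreover have "\<beta> 0 = (?d j / fact (Suc j)) *\<^sub>R v 0"
      by (simp add: \<beta>(2) g(2) divide_inverse mult_ac)
    ultimately show ?thesis by blast
  qed
  \<comment> \<open>A priori \<open>\<delta>\<close> might vanish to all orders. Vanishing of all
    derivatives up to order \<open>k\<close> would contradict the lower bound.\<close>
  have "\<exists>i\<le>k. ?d i \<noteq> 0"
  proof (rule ccontr)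
    assume "\<not> (\<exists>i\<le>k. ?d i \<noteq> 0)"
    then obtain \<beta> where \<beta>: "(\<beta> \<longlongrightarrow> \<beta> 0) (nhds 0)"
      "\<forall>\<^sub>F u in nhds 0. norm (f u - f 0) = \<bar>u\<bar> ^ Suc (Suc k) * norm (\<beta> u :: real^2)"
      using ex[of "Suc k"] by (auto simp: less_Suc_eq_le)
    have "\<forall>\<^sub>F u in nhds 0. norm (\<beta> u) < norm (\<beta> 0) + 1"
      using tendsto_norm[OF \<beta>(1)] by (rule order_tendstoD) simp
    with bound(2) \<beta>(2) have "\<forall>\<^sub>F u in nhds 0. c * \<bar>u\<bar> ^ Suc k \<le> (norm (\<beta> 0) + 1) * \<bar>u\<bar> ^ Suc (Suc k)"
    proof eventually_elim
      case (elim u)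
      have "\<bar>u\<bar> ^ Suc (Suc k) * norm (\<beta> u) \<le> \<bar>u\<bar> ^ Suc (Suc k) * (norm (\<beta> 0) + 1)"
        using elim(3) by (intro mult_left_mono) auto
      with elim(1,2) show ?case by (simp only: mult.commute)
    qed
    from power_bound_imp_le[OF bound(1) this] show False by simp
  qed
  then obtain j where j: "j \<le> k" "?d j \<noteq> 0" "\<forall>i<j. ?d i = 0"
    using exists_least_iff[of "\<lambda>i. i \<le> k \<and> ?d i \<noteq> 0"] by auto
  obtain \<beta> where \<beta>: "(\<beta> \<longlongrightarrow> \<beta> 0) (nhds 0)" "\<beta> 0 = (?d j / fact (Suc j)) *\<^sub>R v 0"
    "\<forall>\<^sub>F u in nhds 0. norm (f u - f 0) = \<bar>u\<bar> ^ Suc j * norm (\<beta> u :: real^2)"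
    using ex[OF j(3)] by blast
  have nz: "norm (\<beta> 0) > 0" using \<beta>(2) j(2) s(3) by simp
  then have "\<forall>\<^sub>F u in nhds 0. norm (\<beta> 0) / 2 < norm (\<beta> u)"
    using tendsto_norm[OF \<beta>(1)] by (intro order_tendstoD) auto
  with bound(3) \<beta>(3) have "\<forall>\<^sub>F u in nhds 0. norm (\<beta> 0) / 2 * \<bar>u\<bar> ^ Suc j \<le> C * \<bar>u\<bar> ^ Suc k"
  proof eventually_elim
    case (elim u)
    have "\<bar>u\<bar> ^ Suc j * (norm (\<beta> 0) / 2) \<le> \<bar>u\<bar> ^ Suc j * norm (\<beta> u)"
      using elim(3) by (intro mult_left_mono) auto
    with elim(1,2) show ?case by (simp only: mult.commute)
  qed
  \<comment> \<open>The upper bound excludes \<open>j < k\<close>.\<close>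
  from power_bound_imp_le[OF _ this] nz have "k \<le> j" by simp
  with j show ?thesis by (auto simp: zero_of_order_def)
qed

text \<open>With \<open>d = p - q\<close> the expression equals
  \<open>d * deriv q - q * deriv d\<close>. The second term has order exactly \<open>m - 1\<close>,
  since \<open>q 0 \<noteq> 0\<close>, and the first has order at least \<open>m\<close>.\<close>

lemma zero_of_order_Wronskian:
  fixes p q :: "real \<Rightarrow> real"
  assumes e: "0 < e" and s: "smooth_on (ball 0 e) p" "smooth_on (ball 0 e) q"
    and q0: "q 0 \<noteq> 0" and m: "m \<ge> 1" and ord: "zero_of_order m (\<lambda>u. p u - q u)"
  shows "zero_of_order (m - 1) (\<lambda>u. p u * deriv q u - q u * deriv p u)"
proof -
  have sd: "smooth_on (ball 0 e) (\<lambda>u. p u - q u)"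
    by (intro smooth_on_intros s open_ball)
  obtain g where g: "smooth_on (ball 0 e) g" "g 0 \<noteq> 0"
    "\<And>u. u \<in> ball 0 e \<Longrightarrow> p u - q u = u ^ m * g u"
    using ord zero_of_order_iff[OF e sd] by blast
  obtain n where n: "m = Suc n" using m by (cases m) auto
  let ?h = "\<lambda>u. u * g u * deriv q u - q u * (real m * g u + u * deriv g u)"
  have "p u * deriv q u - q u * deriv p u = u ^ n * ?h u" if u: "u \<in> ball 0 e" for u
  proof -
    have D: "((\<lambda>u. u ^ m * g u) has_real_derivative u ^ n * (real m * g u + u * deriv g u)) (at u)"
      by (rule DERIV_cong[OF DERIV_mult[OF DERIV_pow smooth_on_has_real_derivative[OF open_ball g(1) u]]])
        (simp add: n algebra_simps)
    have "((\<lambda>u. p u - q u) has_real_derivative u ^ n * (real m * g u + u * deriv g u)) (at u)"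
      by (rule has_field_derivative_transform_within_open[OF D open_ball u]) (simp add: g(3))
    moreover have "((\<lambda>u. p u - q u) has_real_derivative deriv p u - deriv q u) (at u)"
      by (intro DERIV_diff smooth_on_has_real_derivative[OF open_ball _ u] s)
    ultimately have "deriv p u = deriv q u + u ^ n * (real m * g u + u * deriv g u)"
      using DERIV_unique by fastforce
    moreover have "p u = q u + u ^ n * (u * g u)" using g(3)[OF u] by (simp add: n algebra_simps)
    ultimately show ?thesis by (simp add: algebra_simps)
  qed
  moreover have "smooth_on (ball 0 e) ?h"
    by (intro smooth_on_intros g s open_ball)
  moreover have "?h 0 \<noteq> 0" using g(2) q0 m by simp
  moreover have mn: "m - 1 = n" by (simp add: n)
  have sw: "smooth_on (ball 0 e) (\<lambda>u. p u * deriv q u - q u * deriv p u)"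
    by (intro smooth_on_intros s open_ball)
  ultimately show ?thesis
    unfolding zero_of_order_iff[OF e sw] mn by (intro exI[of _ ?h]) blast
qed

section \<open>Parallel pairs\<close>

theorem theorem4p1:
  fixes \<gamma>p \<gamma>m :: "real \<Rightarrow> real^2" and \<rho>p \<rho>m :: "real \<Rightarrow> real" and \<theta>0 :: real
  assumes "angularly_regular_parallel_pair \<gamma>p \<gamma>m \<rho>p \<rho>m \<theta>0"
    and "det2 (\<gamma>p 0 - \<gamma>m 0) (unit_vec \<theta>0) \<noteq> 0"
    and "\<rho>p 0 = \<rho>m 0" and "\<rho>m 0 \<noteq> 0"
  shows "(\<forall>m\<ge>1. zero_of_order m (\<lambda>u. \<rho>p u - \<rho>m u) \<longrightarrow>
            zero_of_order (m - 1) (\<lambda>u. \<rho>p u * deriv \<rho>m u - \<rho>m u * deriv \<rho>p u)) \<and>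
         wigner_caustic \<gamma>p \<gamma>m 0 = centre_symmetry \<gamma>p \<gamma>m \<rho>p \<rho>m 0 \<and>
         centre_symmetry \<gamma>p \<gamma>m \<rho>p \<rho>m 0 = (1/2) *\<^sub>R (\<gamma>p 0 + \<gamma>m 0) \<and>
         (cusp_3_2 (wigner_caustic \<gamma>p \<gamma>m) \<longrightarrow>
            regular_at_0 (centre_symmetry \<gamma>p \<gamma>m \<rho>p \<rho>m)) \<and>
         (cusp_4_3 (wigner_caustic \<gamma>p \<gamma>m) \<longrightarrow>
            cusp_3_2 (centre_symmetry \<gamma>p \<gamma>m \<rho>p \<rho>m)) \<and>
         (cusp_5_4 (wigner_caustic \<gamma>p \<gamma>m) \<or> cusp_5_4_pm7 (wigner_caustic \<gamma>p \<gamma>m) \<longrightarrow>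
            cusp_4_3 (centre_symmetry \<gamma>p \<gamma>m \<rho>p \<rho>m))"
proof -

  \<comment> \<open>A common neighbourhood on which the sum of the radii does not vanish\<close>
  from assms(1) obtain Up Um Vp Vm Wp Wm where
      U: "open Up" "0 \<in> Up" "smooth_on Up \<gamma>p" "open Um" "0 \<in> Um" "smooth_on Um \<gamma>m"
    and V: "open Vp" "0 \<in> Vp" "smooth_on Vp \<rho>p" "open Vm" "0 \<in> Vm" "smooth_on Vm \<rho>m"
    and W: "open Wp" "0 \<in> Wp" "\<forall>u\<in>Wp. vector_derivative \<gamma>p (at u) = \<rho>p u *\<^sub>R unit_vec (u + \<theta>0)"
      "open Wm" "0 \<in> Wm" "\<forall>u\<in>Wm. vector_derivative \<gamma>m (at u) = - \<rho>m u *\<^sub>R unit_vec (u + \<theta>0)"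
    unfolding angularly_regular_parallel_pair_iff smooth_germ_def eventually_nhds by blast
  define T where "T = (Up \<inter> Um) \<inter> (Vp \<inter> Vm) \<inter> (Wp \<inter> Wm)"
  have T: "open T" "0 \<in> T" using U V W by (auto simp: T_def)
  obtain e0 where e0: "0 < e0" "ball 0 e0 \<subseteq> T" using openE[OF T] .
  have "smooth_on (ball 0 e0) \<rho>p" "smooth_on (ball 0 e0) \<rho>m"
    using smooth_on_subset[OF V(3)] smooth_on_subset[OF V(6)] e0(2) by (auto simp: T_def)
  \<comment> \<open>At 0 the sum of the radii is \<open>2 * \<rho>m 0\<close>, of either sign; its
    square fits the positivity lemma.\<close>
  then have "smooth_on (ball 0 e0) (\<lambda>u. (\<rho>p u + \<rho>m u)\<^sup>2)"
    by (intro smooth_on_intros open_ball)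
  then obtain e where e: "0 < e" "e \<le> e0" "\<And>u. u \<in> ball 0 e \<Longrightarrow> (\<rho>p u + \<rho>m u)\<^sup>2 > 0"
    by (rule smooth_on_pos_ball[OF e0(1)]) (use assms(3,4) that in auto)
  have \<Sigma>: "\<rho>p u + \<rho>m u \<noteq> 0" if "u \<in> ball 0 e" for u
    using e(3)[OF that] by simp
  have sub: "ball 0 e \<subseteq> T" using subset_ball[OF e(2), of 0] e0(2) by blast
  have in0: "0 \<in> ball (0::real) e" using e(1) by simp
  have s\<rho>: "smooth_on (ball 0 e) \<rho>p" "smooth_on (ball 0 e) \<rho>m"
    and s\<gamma>: "smooth_on (ball 0 e) \<gamma>p" "smooth_on (ball 0 e) \<gamma>m"
    using smooth_on_subset[OF V(3)] smooth_on_subset[OF V(6)]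
      smooth_on_subset[OF U(3)] smooth_on_subset[OF U(6)] sub by (auto simp: T_def)
  have D\<gamma>p: "(\<gamma>p has_vector_derivative \<rho>p u *\<^sub>R unit_vec (u + \<theta>0)) (at u)"
    and D\<gamma>m: "(\<gamma>m has_vector_derivative - \<rho>m u *\<^sub>R unit_vec (u + \<theta>0)) (at u)" if "u \<in> ball 0 e" for u
    using smooth_on_has_vector_derivative[OF open_ball s\<gamma>(1) that]
      smooth_on_has_vector_derivative[OF open_ball s\<gamma>(2) that] W(3,6) sub that
    by (auto simp: T_def)

  \<comment> \<open>Velocities of the chord, the Wigner caustic and the centre symmetry set\<close>
  let ?E = "wigner_caustic \<gamma>p \<gamma>m" and ?S = "centre_symmetry \<gamma>p \<gamma>m \<rho>p \<rho>m"
  let ?\<Delta> = "\<lambda>u. \<gamma>p u - \<gamma>m u" and ?\<delta> = "\<lambda>u. \<rho>p u - \<rho>m u" and ?\<sigma> = "\<lambda>u. \<rho>p u + \<rho>m u"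
  let ?J = "\<lambda>u. \<rho>p u * deriv \<rho>m u - \<rho>m u * deriv \<rho>p u"
  have sS: "smooth_on (ball 0 e) ?S"
    unfolding centre_symmetry_def by (intro smooth_on_intros s\<rho> s\<gamma> \<Sigma> open_ball)
  have s\<Delta>: "smooth_on (ball 0 e) ?\<Delta>" and s\<delta>: "smooth_on (ball 0 e) (\<lambda>u. ?\<delta> u / 2)"
    and s\<delta>': "smooth_on (ball 0 e) ?\<delta>" and sJ: "smooth_on (ball 0 e) ?J"
    by (intro smooth_on_intros s\<gamma> s\<rho> open_ball; simp)+
  have D\<Delta>: "(?\<Delta> has_vector_derivative ?\<sigma> u *\<^sub>R unit_vec (u + \<theta>0)) (at u)" if "u \<in> ball 0 e" for u
    using has_vector_derivative_diff[OF D\<gamma>p[OF that] D\<gamma>m[OF that]] by (simp add: scaleR_add_left)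
  have DE: "(?E has_vector_derivative (?\<delta> u / 2) *\<^sub>R unit_vec (u + \<theta>0)) (at u)" if "u \<in> ball 0 e" for u
  proof -
    have "((\<lambda>u. (1/2) *\<^sub>R (\<gamma>p u + \<gamma>m u)) has_vector_derivative
        (1/2) *\<^sub>R (\<rho>p u *\<^sub>R unit_vec (u + \<theta>0) + - \<rho>m u *\<^sub>R unit_vec (u + \<theta>0))) (at u)"
      by (intro bounded_linear.has_vector_derivative[OF bounded_linear_scaleR_right]
          has_vector_derivative_add D\<gamma>p D\<gamma>m that)
    then show ?thesis
      by (simp add: wigner_caustic_def[abs_def] algebra_simps diff_divide_distrib)
  qed
  \<comment> \<open>The velocity of the centre symmetry set points along the chord: the contributions along the
    common tangent direction cancel.\<close>
  have DS: "(?S has_vector_derivative (?J u / (?\<sigma> u)\<^sup>2) *\<^sub>R ?\<Delta> u) (at u)" if u: "u \<in> ball 0 e" for u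
  proof -
    have "((\<lambda>u. \<rho>m u / ?\<sigma> u) has_real_derivative
        (deriv \<rho>m u * ?\<sigma> u - \<rho>m u * (deriv \<rho>p u + deriv \<rho>m u)) / (?\<sigma> u * ?\<sigma> u)) (at u)"
      by (intro DERIV_divide DERIV_add smooth_on_has_real_derivative[OF open_ball _ u] s\<rho> \<Sigma> u)
    then have "((\<lambda>u. \<rho>m u / ?\<sigma> u) has_real_derivative ?J u / (?\<sigma> u)\<^sup>2) (at u)"
      by (rule DERIV_cong) (simp add: algebra_simps power2_eq_square)
    from has_vector_derivative_add[OF D\<gamma>m[OF u] has_vector_derivative_scaleR[OF this D\<Delta>[OF u]]]
    have "(?S has_vector_derivative - \<rho>m u *\<^sub>R unit_vec (u + \<theta>0) +
        ((\<rho>m u / ?\<sigma> u) *\<^sub>R ?\<sigma> u *\<^sub>R unit_vec (u + \<theta>0) + (?J u / (?\<sigma> u)\<^sup>2) *\<^sub>R ?\<Delta> u)) (at u)"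
      by (simp only: centre_symmetry_def[abs_def])
    then show ?thesis using \<Sigma>[OF u] by simp
  qed

  \<comment> \<open>Orders of the velocities, and cusps of the centre symmetry set\<close>
  have J_order: "zero_of_order (m - 1) ?J" if "m \<ge> 1" "zero_of_order m ?\<delta>" for m
    by (rule zero_of_order_Wronskian[OF e(1) s\<rho> assms(4) that])
  \<comment> \<open>\<open>Suc k\<close> is the leading exponent of the cusp model, and
    \<open>h\<close> is the quotient of its second coordinate by the first.\<close>
  have \<delta>_order: "zero_of_order k ?\<delta>"
    if E: "becomes ?E (\<lambda>t. vector [t ^ Suc k, t ^ Suc k * h t])" and h: "isCont h 0" for k h
  proof -
    have sv: "smooth_on (ball 0 e) (\<lambda>u. unit_vec (u + \<theta>0))"
    proof -
      have "smooth_on (ball 0 e) (\<lambda>u. cos (u + \<theta>0) *\<^sub>R (axis 1 1 :: real^2) + sin (u + \<theta>0) *\<^sub>R axis 2 1)"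
        by (intro smooth_on_intros smooth_on_cos smooth_on_sin open_ball)
      moreover have "cos (u + \<theta>0) *\<^sub>R (axis 1 1 :: real^2) + sin (u + \<theta>0) *\<^sub>R axis 2 1 = unit_vec (u + \<theta>0)" for u
        by (simp add: unit_vec_def vec_eq_iff forall_2 axis_def)
      ultimately show ?thesis by simp
    qed
    \<comment> \<open>A zero direction would make the determinant in the hypothesis vanish.\<close>
    have "unit_vec (0 + \<theta>0) \<noteq> 0"
      using assms(2) det2_linear(3)[of "?\<Delta> 0" 0 0] by auto
    from becomes_order[OF E h] obtain c C where "0 < c"
      "\<forall>\<^sub>F u in nhds 0. c * \<bar>u\<bar> ^ Suc k \<le> norm (?E u - ?E 0)"
      "\<forall>\<^sub>F u in nhds 0. norm (?E u - ?E 0) \<le> C * \<bar>u\<bar> ^ Suc k" by blast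
    from zero_of_order_speed[OF e(1) s\<delta> sv \<open>unit_vec (0 + \<theta>0) \<noteq> 0\<close> DE this]
    have "zero_of_order k (\<lambda>u. ?\<delta> u / 2)" .
    from this[unfolded zero_of_order_iff[OF e(1) s\<delta>]]
    obtain g where g: "smooth_on (ball 0 e) g" "g 0 \<noteq> 0"
      "\<And>u. u \<in> ball 0 e \<Longrightarrow> ?\<delta> u / 2 = u ^ k * g u" by blast
    have "smooth_on (ball 0 e) (\<lambda>u. 2 * g u)" by (intro smooth_on_intros g open_ball)
    moreover have "?\<delta> u = u ^ k * (2 * g u)" if "u \<in> ball 0 e" for u
      using g(3)[OF that] by (simp add: field_simps)
    ultimately show ?thesis
      unfolding zero_of_order_iff[OF e(1) s\<delta>'] using g(2) by (intro exI[of _ "\<lambda>u. 2 * g u"]) simp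
  qed
  \<comment> \<open>The chord has derivative
    \<open>?\<sigma> 0 *\<^sub>R unit_vec (0 + \<theta>0)\<close> at 0, so the hypothesis on the
    determinant gives the transversality that \<open>frontal_cusp\<close> asks for.\<close>
  have det: "det2 (?\<Delta> 0) (?\<sigma> 0 *\<^sub>R unit_vec (0 + \<theta>0)) \<noteq> 0"
    using assms(2) \<Sigma>[OF in0] by (simp add: det2_linear(3))
  have S_cusp: "(i = 1 \<longrightarrow> cusp_3_2 ?S) \<and> (i = 2 \<longrightarrow> cusp_4_3 ?S)" if "zero_of_order i ?J" for i
  proof -
    from that[unfolded zero_of_order_iff[OF e(1) sJ]]
    obtain g where g: "smooth_on (ball 0 e) g" "g 0 \<noteq> 0"
      "\<And>u. u \<in> ball 0 e \<Longrightarrow> ?J u = u ^ i * g u" by blast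
    have q: "smooth_on (ball 0 e) (\<lambda>u. g u / (?\<sigma> u)\<^sup>2)"
      by (intro smooth_on_intros g s\<rho> open_ball) (use \<Sigma> in auto)
    have q0: "g 0 / (?\<sigma> 0)\<^sup>2 \<noteq> 0" using g(2) \<Sigma>[OF in0] by simp
    have "(?S has_vector_derivative (u ^ i * (g u / (?\<sigma> u)\<^sup>2)) *\<^sub>R ?\<Delta> u) (at u)" if "u \<in> ball 0 e" for u
      using DS[OF that] unfolding g(3)[OF that] by simp
    from frontal_cusp[OF e(1) sS s\<Delta> q q0 this D\<Delta>[OF in0] det] show ?thesis by blast
  qed
  have cont: "isCont (\<lambda>t::real. t) 0" "isCont (\<lambda>t::real. t + t ^ 3) 0" "isCont (\<lambda>t::real. t - t ^ 3) 0"
    by (intro continuous_intros)+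

  \<comment> \<open>The three implications between cusps\<close>
  have i: "regular_at_0 ?S" if "cusp_3_2 ?E"
  proof -
    have "becomes ?E (\<lambda>t. vector [t ^ Suc 1, t ^ Suc 1 * t])"
      using that by (simp add: cusp_3_2_def power2_eq_square power3_eq_cube)
    \<comment> \<open>Leading exponent 2: \<open>?\<delta>\<close> has order 1 and \<open>?J\<close>
      order 0, so the velocity of \<open>?S\<close> at 0 is a nonzero multiple of the chord.\<close>
    from J_order[OF _ \<delta>_order[OF this cont(1)]] have "?J 0 \<noteq> 0"
      by (simp add: zero_of_order_def)
    moreover have "?\<Delta> 0 \<noteq> 0" using assms(2) det2_linear(2)[of 0 0] by force
    ultimately have "vector_derivative ?S (at 0) \<noteq> 0"
      unfolding vector_derivative_at[OF DS[OF in0]] using \<Sigma>[OF in0] by simp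
    moreover have "smooth_germ 0 ?S"
      unfolding smooth_germ_def using in0 sS open_ball by blast
    ultimately show ?thesis by (simp add: regular_at_0_def)
  qed
  have ii: "cusp_3_2 ?S" if "cusp_4_3 ?E"
  proof -
    have "becomes ?E (\<lambda>t. vector [t ^ Suc 2, t ^ Suc 2 * t])"
      using that by (simp add: cusp_4_3_def power_Suc2[symmetric] del: power_Suc)
    \<comment> \<open>Leading exponent 3: \<open>?\<delta>\<close> has order 2 and \<open>?J\<close>
      order 1.\<close>
    from S_cusp[OF J_order[OF _ \<delta>_order[OF this cont(1)]]] show ?thesis by simp
  qed
  have iii: "cusp_4_3 ?S" if "cusp_5_4 ?E \<or> cusp_5_4_pm7 ?E"
  proof -
    have pow: "t ^ 4 * t = t ^ 5" "t ^ 4 * (t + t ^ 3) = t ^ 5 + t ^ 7" "t ^ 4 * (t - t ^ 3) = t ^ 5 - t ^ 7"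
      for t :: real
      using power_Suc2[of t 4] power_add[of t 4 3] by (simp_all add: distrib_left right_diff_distrib)
    \<comment> \<open>The three models share the leading exponent 4 and differ in \<open>h\<close>,
      so one order computation serves them all.\<close>
    have "becomes ?E (\<lambda>t. vector [t ^ 4, t ^ 4 * t]) \<or>
        becomes ?E (\<lambda>t. vector [t ^ 4, t ^ 4 * (t + t ^ 3)]) \<or>
        becomes ?E (\<lambda>t. vector [t ^ 4, t ^ 4 * (t - t ^ 3)])"
      unfolding pow using that by (simp add: cusp_5_4_def cusp_5_4_pm7_def)
    then have "\<exists>h. isCont h 0 \<and> becomes ?E (\<lambda>t. vector [t ^ 4, t ^ 4 * h t])"
    proof (elim disjE)
      assume "becomes ?E (\<lambda>t. vector [t ^ 4, t ^ 4 * t])"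
      with cont(1) show ?thesis by (intro exI[of _ "\<lambda>t. t"]) simp
    next
      assume "becomes ?E (\<lambda>t. vector [t ^ 4, t ^ 4 * (t + t ^ 3)])"
      with cont(2) show ?thesis by (intro exI[of _ "\<lambda>t. t + t ^ 3"] conjI)
    next
      assume "becomes ?E (\<lambda>t. vector [t ^ 4, t ^ 4 * (t - t ^ 3)])"
      with cont(3) show ?thesis by (intro exI[of _ "\<lambda>t. t - t ^ 3"] conjI)
    qed
    moreover have "Suc 3 = 4" by simp
    ultimately obtain h where "isCont h 0" "becomes ?E (\<lambda>t. vector [t ^ Suc 3, t ^ Suc 3 * h t])"
      by auto
    \<comment> \<open>Leading exponent 4: \<open>?\<delta>\<close> has order 3 and \<open>?J\<close>
      order 2.\<close>
    from S_cusp[OF J_order[OF _ \<delta>_order[OF this(2,1)]]] show ?thesis by simp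
  qed
  \<comment> \<open>Equal nonzero radii make the weight
    \<open>\<rho>m 0 / (\<rho>p 0 + \<rho>m 0)\<close> equal to one half.\<close>
  have "?S 0 = (1/2) *\<^sub>R (\<gamma>p 0 + \<gamma>m 0)"
    using assms(3,4) by (simp add: centre_symmetry_def vec_eq_iff field_simps)
  then show ?thesis
    using J_order i ii iii by (auto simp: wigner_caustic_def)
qed

end
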